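(* Let $b=(t;\mathsf T)\in\mathcal M_\bullet$. Then $$\boldsymbol\rho(M_b)=\begin{cases}\displaystyle\sum_{b=c\backslash s}M_c\otimes M_s,&\text{if }b\neq\beta(\mathsf{max}(t)),\\[2ex]\displaystyle\sum_{b=c\backslash s}M_c\otimes M_s\;+\;1\otimes M_t,&\text{if }b=\beta(\mathsf{max}(t)),\end{cases}$$ where the sums are over all pairs $(c,s)$ with $c\in\mathcal M_p$, $p\ge1$, $s\in\mathcal Y_q$, $q\ge0$, and $b=c\backslash s$.
   Context: Permutations. $\mathfrak S_n$ is the set of permutations of $\{1,\dots,n\}$ written as words ($\mathfrak S_0=\{\emptyset\}$), with the weak order whose covers are $w\lessdot(k,k+1)w$ when the value $k$ occurs before $k+1$ in $w$ (and $(k,k+1)w$ swaps these two values). $\overline a$ denotes the standardization of a word $a$ with distinct letters. Trees. $\mathcal Y_n$ is the set of rooted planar binary trees with $n$ internal nodes; $|$ is the tree with no nodes; $t_\ell\vee t_r$ is the tree whose root node has left and right subtrees $t_\ell,t_r$. A tree in $\mathcal Y_n$ has leaves numbered $0,\dots,n$ and nodes numbered $1,\dots,n$ from left to right (node $i$ is the gap between leaves $i-1$ and $i$). Its node poset has the internal edges as Hasse diagram and the root as maximum. The Tamari order on $\mathcal Y_n$ has covers given by replacing a subtree $(x\vee y)\vee z$ by $x\vee(y\vee z)$. The map $\tau\colon\mathfrak S_n\to\mathcal Y_n$ is given by $\tau(\emptyset)=|$ and, if $w(j)=n$, $\tau(w)=\tau(\overline{w(1)\cdots w(j-1)})\vee\tau(\overline{w(j+1)\cdots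 w(n)})$. Its fibers are intervals in the weak order (Loday–Ronco), and $\mathsf{max}(t)$ is the maximum of $\tau^{-1}(t)$ (the unique $132$-avoiding element). Bi-leveled trees. $\mathcal M_n$ is the set of pairs $(t;\mathsf T)$ with $t\in\mathcal Y_n$ and $\mathsf T\subseteq\{1,\dots,n\}$ an upper order ideal of the node poset of $t$ containing the leftmost node (node $1$) as a minimal element of $\mathsf T$; $\mathcal M_0=\{|\}$; $\mathcal M_\bullet=\bigsqcup_n\mathcal M_n$. The order on $\mathcal M_n$ is $(s;\mathsf S)\le(t;\mathsf T)$ iff $s\le t$ in the Tamari order and $\mathsf S\supseteq\mathsf T$. $\beta\colon\mathfrak S_n\to\mathcal M_n$ is $\beta(w)=(\tau(w);\{i\mid w(i)\ge w(1)\})$. For $c\in\mathcal M_p$ with $p\ge1$ and $s\in\mathcal Y_q$, $c\backslash s\in\mathcal M_{p+q}$ is the bi-leveled tree whose underlying tree is obtained by grafting the root of $s$ onto the rightmost leaf of the underlying tree of $c$, with order ideal that of $c$. Spaces and bases. $\mathcal MSym$ and $\mathcal YSym$ are the graded $\mathbb Q$-vector spaces with bases $\{F_b\mid b\in\mathcal M_\bullet\}$ and $\{F_t\mid t\in\mathcal Y_n,n\ge0\}$; $1=F_|$ in each. With $\mu$ the Möbius function of the relevant poset ($\mathcal M_n$, resp. $\mathcal Y_n$ with the Tamari order), $M_b=\sum_{b\le c}\mu(b,c)F_c$ and $M_t=\sum_{t\le s}\mu(t,s)F_s$. Coaction. Splitting $t\in\mathcal Y_n$ along leaf $i$ means cutting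 along the path from leaf $i$ to the root, giving $t\to(t_0,t_1)$ with $t_0\in\mathcal Y_i$ containing nodes $1,\dots,i$ and $t_1$ containing nodes $i+1,\dots,n$; equivalently, $t_0=\tau(\overline{w(1)\cdots w(i)})$, $t_1=\tau(\overline{w(i+1)\cdots w(n)})$ for any $w\in\tau^{-1}(t)$. For $b=(t;\mathsf T)$ it induces $b\to(b_0,b_1)$ with $b_i=(t_i;\mathsf T|_{t_i})$; $b_0$ is bi-leveled and $\phi(b_1)=t_1$. The linear map $\boldsymbol\rho\colon\mathcal MSym\to\mathcal MSym\otimes\mathcal YSym$ is $\boldsymbol\rho(F_b)=\sum_{b\to(b_0,b_1)}F_{b_0}\otimes F_{\phi(b_1)}$, the sum over splittings along one leaf. *)

theory Defs
  imports
    Complex_Main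
    "HOL-Library.Tree"
    "HOL-Library.Poly_Mapping"
    "HOL-Combinatorics.Multiset_Permutations"
begin

section \<open>Permutations and the weak order\<close>

text \<open>A permutation of \<open>{1..n}\<close> is a word, i.e. an element of \<open>permutations_of_set {1..n}\<close>;
  its letter \<open>w(i)\<close> is \<open>w ! (i - 1)\<close>.\<close>

definition weak_cover :: "nat list \<Rightarrow> nat list \<Rightarrow> bool" where
  "weak_cover w w' \<longleftrightarrow>
     (\<exists>k i j. i < j \<and> j < length w \<and> w ! i = k \<and> w ! j = Suc k \<and>
        w' = map (Transposition.transpose k (Suc k)) w)"

definition weak_le :: "nat list \<Rightarrow> nat list \<Rightarrow> bool" where
  "weak_le = weak_cover\<^sup>*\<^sup>*"

definition standardize :: "nat list \<Rightarrow> nat list" where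
  "standardize w = map (\<lambda>a. card {b \<in> set w. b \<le> a}) w"

lemma length_standardize [simp]: "length (standardize w) = length w"
  by (simp add: standardize_def)

section \<open>Planar binary trees\<close>

text \<open>Internal nodes carry no data, so the trees in \<open>\<Y>\<^sub>n\<close> are the \<open>pbt\<close>s of size \<open>n\<close>.
  Nodes are numbered \<open>1, \<dots>, n\<close> and leaves \<open>0, \<dots>, n\<close> from left to right.\<close>

type_synonym pbt = "unit tree"

abbreviation vee :: "pbt \<Rightarrow> pbt \<Rightarrow> pbt" (infix "\<^bold>\<or>" 65) where
  "l \<^bold>\<or> r \<equiv> Node l () r"

definition Ytrees :: "nat \<Rightarrow> pbt set" where
  "Ytrees n = {t. size t = n}"

definition root_node :: "pbt \<Rightarrow> nat" where
  "root_node t = Suc (size (left t))"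

text \<open>Internal edges, as pairs (child, parent) of nodes.\<close>

fun node_edges :: "pbt \<Rightarrow> (nat \<times> nat) set" where
  "node_edges Leaf = {}"
| "node_edges (Node l u r) =
     (let k = Suc (size l) in
        (if l = Leaf then {} else {(root_node l, k)}) \<union>
        (if r = Leaf then {} else {(k + root_node r, k)}) \<union>
        node_edges l \<union> map_prod ((+) k) ((+) k) ` node_edges r)"

definition node_le :: "pbt \<Rightarrow> nat \<Rightarrow> nat \<Rightarrow> bool" where
  "node_le t i j \<longleftrightarrow> (i, j) \<in> (node_edges t)\<^sup>*"

inductive tamari_cover :: "pbt \<Rightarrow> pbt \<Rightarrow> bool" where
  rotate: "tamari_cover ((x \<^bold>\<or> y) \<^bold>\<or> z) (x \<^bold>\<or> (y \<^bold>\<or> z))"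
| left: "tamari_cover l l' \<Longrightarrow> tamari_cover (l \<^bold>\<or> r) (l' \<^bold>\<or> r)"
| right: "tamari_cover r r' \<Longrightarrow> tamari_cover (l \<^bold>\<or> r) (l \<^bold>\<or> r')"

definition tamari_le :: "pbt \<Rightarrow> pbt \<Rightarrow> bool" where
  "tamari_le = tamari_cover\<^sup>*\<^sup>*"

definition tamari_order :: "nat \<Rightarrow> (pbt \<times> pbt) set" where
  "tamari_order n = {(s, t). s \<in> Ytrees n \<and> t \<in> Ytrees n \<and> tamari_le s t}"

text \<open>For a permutation \<open>w\<close> of \<open>{1..n}\<close> with \<open>n > 0\<close>, \<open>Max (set w)\<close> is \<open>n\<close>.\<close>

function tau :: "nat list \<Rightarrow> pbt" where
  "tau w = (if w = [] then Leaf else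
     (let m = Max (set w) in
        tau (standardize (takeWhile (\<lambda>a. a \<noteq> m) w)) \<^bold>\<or>
        tau (standardize (tl (dropWhile (\<lambda>a. a \<noteq> m) w)))))"
  by pat_completeness auto
termination
proof (relation "measure length", goal_cases)
  case 1
  then show ?case by simp
next
  case (2 w m)
  have "Max (set w) \<in> set w" using 2 by (intro Max_in) auto
  then have "length (takeWhile (\<lambda>a. a \<noteq> m) w) < length w"
    using 2 by (metis (mono_tags, lifting) length_takeWhile_le nat_less_le
        nth_mem set_takeWhileD takeWhile_eq_take take_all_iff)
  then show ?case by simp
next
  case (3 w m)
  have "length (dropWhile (\<lambda>a. a \<noteq> m) w) \<le> length w" by (rule length_dropWhile_le)
  moreover have "length w > 0" using 3 by simp
  ultimately have "length (dropWhile (\<lambda>a. a \<noteq> m) w) - 1 < length w" by linarith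
  then show ?case by simp
qed

declare tau.simps [simp del]

definition fiber :: "pbt \<Rightarrow> nat list set" where
  "fiber t = {w \<in> permutations_of_set {1..size t}. tau w = t}"

text \<open>The maximum of the fiber in the weak order, which exists as the fiber is an interval.\<close>

definition max_perm :: "pbt \<Rightarrow> nat list" where
  "max_perm t = (THE w. w \<in> fiber t \<and> (\<forall>v \<in> fiber t. weak_le v w))"

text \<open>Cutting along the path from leaf \<open>i\<close> to the root; only meaningful for \<open>i \<le> size t\<close>.\<close>

fun split_tree :: "pbt \<Rightarrow> nat \<Rightarrow> pbt \<times> pbt" where
  "split_tree Leaf i = (Leaf, Leaf)"
| "split_tree (Node l u r) i =
     (if i \<le> size l
      then (let (l0, l1) = split_tree l i in (l0, l1 \<^bold>\<or> r))
      else (let (r0, r1) = split_tree r (i - Suc (size l)) in (l \<^bold>\<or> r0, r1)))"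

fun graft_tree :: "pbt \<Rightarrow> pbt \<Rightarrow> pbt" where
  "graft_tree Leaf s = s"
| "graft_tree (Node l u r) s = l \<^bold>\<or> graft_tree r s"

section \<open>Bi-leveled trees\<close>

type_synonym bltree = "pbt \<times> nat set"

text \<open>For \<open>n = 0\<close> there is no leftmost node, and the only bi-leveled tree is \<open>(Leaf, {})\<close>.\<close>

definition bileveled :: "nat \<Rightarrow> bltree set" where
  "bileveled n = {(t, T). t \<in> Ytrees n \<and> T \<subseteq> {1..n} \<and>
     (\<forall>i \<in> T. \<forall>j. node_le t i j \<longrightarrow> j \<in> T) \<and>
     (n \<noteq> 0 \<longrightarrow> 1 \<in> T \<and> (\<forall>i \<in> T. node_le t i 1 \<longrightarrow> i = 1))}"

definition bileveled_trees :: "bltree set" where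
  "bileveled_trees = (\<Union>n. bileveled n)"

definition bl_order :: "nat \<Rightarrow> (bltree \<times> bltree) set" where
  "bl_order n = {((s, S), (t, T)).
     (s, S) \<in> bileveled n \<and> (t, T) \<in> bileveled n \<and> tamari_le s t \<and> T \<subseteq> S}"

definition beta :: "nat list \<Rightarrow> bltree" where
  "beta w = (tau w, {i \<in> {1..length w}. w ! (i - 1) \<ge> w ! 0})"

definition graft :: "bltree \<Rightarrow> pbt \<Rightarrow> bltree" where
  "graft c s = (graft_tree (fst c) s, snd c)"

text \<open>The nodes \<open>i + 1, \<dots>, n\<close> of \<open>t\<close> become the nodes \<open>1, \<dots>, n - i\<close> of the second part.  The second
  part need not be bi-leveled; \<open>\<phi>\<close> forgets its order ideal.\<close>

definition split_bl :: "bltree \<Rightarrow> nat \<Rightarrow> bltree \<times> bltree" where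
  "split_bl b i =
     ((fst (split_tree (fst b) i), snd b \<inter> {1..i}),
      (snd (split_tree (fst b) i), {j. 1 \<le> j \<and> i + j \<in> snd b}))"

definition phi :: "bltree \<Rightarrow> pbt" where
  "phi b = fst b"

section \<open>The Moebius function of a finite poset\<close>

text \<open>The order is given as a relation \<open>r\<close>; the conditions on \<open>r\<close> ensure termination.\<close>

function mobius :: "('a \<times> 'a) set \<Rightarrow> 'a \<Rightarrow> 'a \<Rightarrow> int" where
  "mobius r x y =
     (if x = y then 1
      else if finite r \<and> trans r \<and> antisym r \<and> (x, y) \<in> r
      then - (\<Sum>z \<in> {z. (x, z) \<in> r \<and> (z, y) \<in> r \<and> z \<noteq> y}. mobius r x z)
      else 0)"
  by pat_completeness auto
termination
proof (relation "measure (\<lambda>(r, x, y). card {z. (z, y) \<in> r \<and> z \<noteq> y})", goal_cases)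
  case 1
  then show ?case by simp
next
  case (2 r x y z)
  then have r: "finite r" "trans r" "antisym r" and z: "(z, y) \<in> r" "z \<noteq> y" by auto
  have "{u. (u, y) \<in> r \<and> u \<noteq> y} \<subseteq> fst ` r" by force
  then have fin: "finite {u. (u, y) \<in> r \<and> u \<noteq> y}"
    using r(1) by (meson finite_imageI finite_subset)
  have "{u. (u, z) \<in> r \<and> u \<noteq> z} \<subset> {u. (u, y) \<in> r \<and> u \<noteq> y}"
    using r(2,3) z by (auto dest: transD antisymD)
  then show ?case using fin by (simp add: psubset_card_mono)
qed

declare mobius.simps [simp del]

text \<open>The posets used here satisfy these conditions.\<close>

lemma finite_Ytrees: "finite (Ytrees n)"
proof (induction n rule: less_induct)
  case (less n)
  let ?A = "\<Union>k<n. Ytrees k"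
  have "Ytrees n \<subseteq> insert Leaf ((\<lambda>(l, r). l \<^bold>\<or> r) ` (?A \<times> ?A))"
  proof
    fix t assume t: "t \<in> Ytrees n"
    show "t \<in> insert Leaf ((\<lambda>(l, r). l \<^bold>\<or> r) ` (?A \<times> ?A))"
      using t by (cases t) (auto simp: Ytrees_def image_iff)
  qed
  moreover have "finite ?A" using less by auto
  ultimately show ?case by (meson finite.insertI finite_SigmaI finite_imageI finite_subset)
qed

lemma tamari_cover_size: "tamari_cover s t \<Longrightarrow> size s = size t"
  by (induction rule: tamari_cover.induct) auto

lemma tamari_le_size: "tamari_le s t \<Longrightarrow> size s = size t"
  unfolding tamari_le_def by (induction rule: rtranclp_induct) (auto dest: tamari_cover_size)

primrec left_weight :: "pbt \<Rightarrow> nat" where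
  "left_weight Leaf = 0"
| "left_weight (Node l u r) = size l + left_weight l + left_weight r"

lemma tamari_cover_left_weight: "tamari_cover s t \<Longrightarrow> left_weight t < left_weight s"
  by (induction rule: tamari_cover.induct) (auto dest: tamari_cover_size)

lemma tamari_le_left_weight: "tamari_le s t \<Longrightarrow> s = t \<or> left_weight t < left_weight s"
  unfolding tamari_le_def
  by (induction rule: rtranclp_induct) (auto dest: tamari_cover_left_weight)

lemma tamari_le_antisym: "tamari_le s t \<Longrightarrow> tamari_le t s \<Longrightarrow> s = t"
  using tamari_le_left_weight by (metis less_asym)

lemma tamari_le_trans: "tamari_le s t \<Longrightarrow> tamari_le t u \<Longrightarrow> tamari_le s u"
  unfolding tamari_le_def by (rule rtranclp_trans)

lemma tamari_le_refl: "tamari_le t t"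
  unfolding tamari_le_def by simp

lemma finite_tamari_order: "finite (tamari_order n)"
  by (rule finite_subset[of _ "Ytrees n \<times> Ytrees n"])
     (auto simp: tamari_order_def finite_Ytrees)

lemma partial_order_tamari: "partial_order_on (Ytrees n) (tamari_order n)"
  by (auto simp: partial_order_on_def preorder_on_def refl_on_def tamari_order_def
      intro!: transI antisymI intro: tamari_le_refl tamari_le_antisym tamari_le_trans)

lemma finite_bileveled: "finite (bileveled n)"
  by (rule finite_subset[of _ "Ytrees n \<times> Pow {1..n}"])
     (auto simp: bileveled_def finite_Ytrees)

lemma finite_bl_order: "finite (bl_order n)"
  by (rule finite_subset[of _ "bileveled n \<times> bileveled n"])
     (auto simp: bl_order_def finite_bileveled)

lemma partial_order_bl: "partial_order_on (bileveled n) (bl_order n)"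
  unfolding partial_order_on_def preorder_on_def
proof (intro conjI)
  show "bl_order n \<subseteq> bileveled n \<times> bileveled n" by (auto simp: bl_order_def)
  show "refl_on (bileveled n) (bl_order n)"
    by (auto simp: refl_on_def bl_order_def intro: tamari_le_refl)
  show "trans (bl_order n)"
    by (rule transI) (auto simp: bl_order_def intro: tamari_le_trans)
  show "antisym (bl_order n)"
    by (rule antisymI) (auto simp: bl_order_def dest: tamari_le_antisym)
qed

lemma mobius_recursion:
  assumes "finite r" "partial_order_on A r" "(x, y) \<in> r" "x \<noteq> y"
  shows "mobius r x y = - (\<Sum>z \<in> {z. (x, z) \<in> r \<and> (z, y) \<in> r \<and> z \<noteq> y}. mobius r x z)"
  using assms by (subst mobius.simps) (auto simp: partial_order_on_def preorder_on_def)

section \<open>The spaces, their bases, and the coaction\<close>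

text \<open>Vector spaces with a given basis are spaces of finitely supported rational functions on the
  basis.  \<open>\<M>Sym\<close> is the subspace of \<open>msym\<close> of functions supported on \<open>bileveled_trees\<close>; this
  contains all \<open>F_bl b\<close> and \<open>M_bl b\<close> with \<open>b \<in> bileveled_trees\<close>.  A tensor product of two such spaces
  is the space with basis the pairs of basis elements.\<close>

type_synonym msym = "bltree \<Rightarrow>\<^sub>0 rat"
type_synonym ysym = "pbt \<Rightarrow>\<^sub>0 rat"

definition F_bl :: "bltree \<Rightarrow> msym" where
  "F_bl b = Poly_Mapping.single b 1"

definition F_tree :: "pbt \<Rightarrow> ysym" where
  "F_tree t = Poly_Mapping.single t 1"

definition scale :: "rat \<Rightarrow> ('a \<Rightarrow>\<^sub>0 rat) \<Rightarrow> ('a \<Rightarrow>\<^sub>0 rat)" where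
  "scale a f = Poly_Mapping.map ((*) a) f"

definition M_bl :: "bltree \<Rightarrow> msym" where
  "M_bl b = (let r = bl_order (size (fst b)) in
     \<Sum>c \<in> {c. (b, c) \<in> r}. scale (of_int (mobius r b c)) (F_bl c))"

definition M_tree :: "pbt \<Rightarrow> ysym" where
  "M_tree t = (let r = tamari_order (size t) in
     \<Sum>s \<in> {s. (t, s) \<in> r}. scale (of_int (mobius r t s)) (F_tree s))"

definition tensor :: "('a \<Rightarrow>\<^sub>0 rat) \<Rightarrow> ('b \<Rightarrow>\<^sub>0 rat) \<Rightarrow> ('a \<times> 'b \<Rightarrow>\<^sub>0 rat)" (infixr "\<^bold>\<otimes>" 70) where
  "f \<^bold>\<otimes> g = (\<Sum>x \<in> Poly_Mapping.keys f. \<Sum>y \<in> Poly_Mapping.keys g.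
     Poly_Mapping.single (x, y) (Poly_Mapping.lookup f x * Poly_Mapping.lookup g y))"

definition one_msym :: msym where
  "one_msym = F_bl (Leaf, {})"

definition rho_F :: "bltree \<Rightarrow> (bltree \<times> pbt \<Rightarrow>\<^sub>0 rat)" where
  "rho_F b = (\<Sum>i \<in> {0..size (fst b)}.
     (case split_bl b i of (b0, b1) \<Rightarrow> F_bl b0 \<^bold>\<otimes> F_tree (phi b1)))"

text \<open>The linear extension of \<open>rho_F\<close>.\<close>

definition rho :: "msym \<Rightarrow> (bltree \<times> pbt \<Rightarrow>\<^sub>0 rat)" where
  "rho f = (\<Sum>b \<in> Poly_Mapping.keys f. scale (Poly_Mapping.lookup f b) (rho_F b))"

lemma lookup_scale [simp]: "Poly_Mapping.lookup (scale a f) x = a * Poly_Mapping.lookup f x"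
  by (simp add: scale_def Poly_Mapping.map.rep_eq when_def)

lemma lookup_tensor:
  "Poly_Mapping.lookup (f \<^bold>\<otimes> g) (x, y) = Poly_Mapping.lookup f x * Poly_Mapping.lookup g y"
proof -
  let ?l = "Poly_Mapping.lookup"
  have 1: "?l (f \<^bold>\<otimes> g) (x, y) = (\<Sum>u \<in> Poly_Mapping.keys f. \<Sum>v \<in> Poly_Mapping.keys g.
      if v = y then (if u = x then ?l f u * ?l g v else 0) else 0)"
    unfolding tensor_def lookup_sum lookup_single when_def
    by (intro sum.cong refl) auto
  have 2: "\<dots> = (\<Sum>u \<in> Poly_Mapping.keys f. if u = x then ?l f u * ?l g y else 0)"
    by (subst sum.delta, simp, rule sum.cong) (auto simp: in_keys_iff)
  have 3: "\<dots> = ?l f x * ?l g y"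
    by (subst sum.delta) (auto simp: in_keys_iff)
  show ?thesis using 1 2 3 by simp
qed

lemma rho_F_bl: "rho (F_bl b) = rho_F b"
  by (rule poly_mapping_eqI) (simp add: rho_def F_bl_def lookup_sum)

lemma lookup_rho:
  assumes "finite B" "Poly_Mapping.keys f \<subseteq> B"
  shows "Poly_Mapping.lookup (rho f) x =
    (\<Sum>b \<in> B. Poly_Mapping.lookup f b * Poly_Mapping.lookup (rho_F b) x)"
  unfolding rho_def lookup_sum lookup_scale
  by (rule sum.mono_neutral_left) (use assms in \<open>auto simp: in_keys_iff\<close>)

lemma rho_linear: "rho (scale a f + scale a' g) = scale a (rho f) + scale a' (rho g)"
proof (rule poly_mapping_eqI)
  fix x
  let ?h = "scale a f + scale a' g"
  let ?B = "Poly_Mapping.keys f \<union> Poly_Mapping.keys g"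
  have k: "Poly_Mapping.keys ?h \<subseteq> ?B"
    by (auto simp: in_keys_iff lookup_add)
  show "Poly_Mapping.lookup (rho ?h) x =
      Poly_Mapping.lookup (scale a (rho f) + scale a' (rho g)) x"
    using lookup_rho[of ?B ?h x] lookup_rho[of ?B f x] lookup_rho[of ?B g x] k
    by (simp add: lookup_add sum_distrib_left sum.distrib algebra_simps)
qed

section \<open>Factorizations\<close>

definition factorizations :: "bltree \<Rightarrow> (bltree \<times> pbt) set" where
  "factorizations b =
     {(c, s). (\<exists>p \<ge> 1. c \<in> bileveled p) \<and> (\<exists>q. s \<in> Ytrees q) \<and> b = graft c s}"

lemma size_graft_tree: "size (graft_tree t s) = size t + size s"
  by (induction t) auto

lemma finite_factorizations: "finite (factorizations b)"
proof (rule finite_subset)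
  let ?A = "\<Union>k \<le> size (fst b). Ytrees k"
  show "factorizations b \<subseteq> (?A \<times> {snd b}) \<times> ?A"
    by (auto simp: factorizations_def graft_def Ytrees_def size_graft_tree)
  show "finite ((?A \<times> {snd b}) \<times> ?A)"
    by (auto simp: finite_Ytrees)
qed

end

theory Submission
  imports Defs
begin

text \<open>By Moebius inversion the formula is equivalent to its sum over an up-set.  Write \<open>N d\<close> for the
  right-hand side claimed for a bi-leveled tree \<open>d\<close>.  If \<open>\<Sum>d \<ge> b. N d = \<rho>(F\<^sub>b)\<close> for every \<open>b\<close>, then
  \<open>N b = \<Sum>c \<ge> b. \<mu>(b, c) \<rho>(F\<^sub>c) = \<rho>(M\<^sub>b)\<close> by linearity of \<open>\<rho>\<close>.  So it remains to expand
  \<open>\<rho>(F\<^sub>b)\<close> for \<open>b = (t; T)\<close> in the basis \<open>M \<otimes> M\<close>; this is lemma \<open>sum_coaction_M\<close>.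

  The splitting \<open>b \<rightarrow> (b\<^sub>0, b\<^sub>1)\<close> along leaf \<open>i\<close> contributes \<open>M\<^sub>c \<otimes> M\<^sub>s\<close> for all \<open>c \<ge> b\<^sub>0\<close> and
  \<open>s \<ge> \<phi>(b\<^sub>1)\<close>.  For \<open>i \<ge> 1\<close> these are exactly the pairs with \<open>c\<close> in degree \<open>i\<close> and \<open>c\s \<ge> b\<close>,
  because splitting is left adjoint to grafting: \<open>t \<le> c\s\<close> iff \<open>t\<^sub>0 \<le> c\<close> and \<open>t\<^sub>1 \<le> s\<close> when \<open>t\<close> is
  split along leaf \<open>size c\<close> (\<open>le_graft_iff\<close>).  This rests on three facts: splitting is monotone,
  splitting undoes grafting, and \<open>t \<le> t\<^sub>0\t\<^sub>1\<close>.

  For \<open>i = 0\<close> the contribution is \<open>1 \<otimes> M\<^sub>s\<close> for all \<open>s \<ge> t\<close>.  The smallest order ideal that makes \<open>s\<close>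
  bi-leveled is its left spine, the chain of nodes from node 1 up to the root, and rotations only
  remove nodes from the left spine.  Hence \<open>s \<ge> t\<close> iff \<open>(s; left spine of s) \<ge> (t; T)\<close>, and the terms
  \<open>1 \<otimes> M\<^sub>s\<close> are indexed by the \<open>d \<ge> b\<close> whose order ideal is the left spine.  Those \<open>d = (s; S)\<close> are
  the ones with \<open>d = \<beta>(max(s))\<close>: in the maximal word of a fiber, every letter left of the largest one
  exceeds every letter right of it, recursively, so the letters that are at least the first one sit
  precisely on the left spine.  To identify that maximum, note that a permutation containing the
  pattern 132 contains it with adjacent values \<open>k\<close> and \<open>k + 1\<close> as the 1 and the 2.  Swapping them goes up
  in the weak order and stays in the fiber, and the only word of the fiber at which this climb can
  end is the one just described (\<open>weak_le_max_word\<close>).\<close>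

section \<open>Moebius inversion\<close>

lemma finite_above: "finite r \<Longrightarrow> finite {c. (b, c) \<in> r}"
  by (rule finite_subset[of _ "snd ` r"]) force+

lemma mobius_sum_interval:
  assumes "finite r" "partial_order_on A r" "(b, d) \<in> r"
  shows "(\<Sum>c \<in> {c. (b, c) \<in> r \<and> (c, d) \<in> r}. mobius r b c) = (if b = d then 1 else 0)"
proof -
  let ?I = "{c. (b, c) \<in> r \<and> (c, d) \<in> r}"
  have po: "refl_on A r" "antisym r" "r \<subseteq> A \<times> A"
    using assms(2) by (auto simp: partial_order_on_def preorder_on_def)
  have fin: "finite ?I" using finite_above[OF assms(1), of b] by simp
  have d: "(d, d) \<in> r" using po assms(3) by (auto simp: refl_on_def)
  show ?thesis
  proof (cases "b = d")
    case True
    then have "?I = {d}" using po(2) d by (auto dest: antisymD)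
    with True show ?thesis by (simp add: mobius.simps[of r d d])
  next
    case False
    have "sum (mobius r b) ?I = mobius r b d + sum (mobius r b) (?I - {d})"
      using fin d assms(3) by (simp add: sum.remove)
    also have "?I - {d} = {z. (b, z) \<in> r \<and> (z, d) \<in> r \<and> z \<noteq> d}" by auto
    finally show ?thesis
      using mobius_recursion[OF assms False] False by simp
  qed
qed

text \<open>After exchanging the two sums, the coefficient of \<open>N d\<close> is the sum of \<open>\<mu>(b, c)\<close> over the interval
  from \<open>b\<close> to \<open>d\<close>, which vanishes unless \<open>d = b\<close>.\<close>

lemma mobius_inversion:
  fixes N :: "'a \<Rightarrow> 'b :: comm_ring_1"
  assumes "finite r" "partial_order_on A r" "b \<in> A"
  shows "(\<Sum>c \<in> {c. (b, c) \<in> r}. of_int (mobius r b c) * (\<Sum>d \<in> {d. (c, d) \<in> r}. N d)) = N b"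
proof -
  have po: "refl_on A r" "trans r"
    using assms(2) by (auto simp: partial_order_on_def preorder_on_def)
  have fin: "finite {d. (c, d) \<in> r}" for c by (rule finite_above[OF assms(1)])
  have "(\<Sum>c \<in> {c. (b, c) \<in> r}. of_int (mobius r b c) * (\<Sum>d \<in> {d. (c, d) \<in> r}. N d))
      = (\<Sum>c \<in> {c. (b, c) \<in> r}. \<Sum>d \<in> {d. d \<in> {d. (b, d) \<in> r} \<and> (c, d) \<in> r}.
            of_int (mobius r b c) * N d)"
    unfolding sum_distrib_left
    by (intro sum.cong refl) (use po(2) in \<open>auto dest: transD\<close>)
  also have "\<dots> = (\<Sum>d \<in> {d. (b, d) \<in> r}. \<Sum>c \<in> {c. c \<in> {c. (b, c) \<in> r} \<and> (c, d) \<in> r}.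
            of_int (mobius r b c) * N d)"
    by (rule sum.swap_restrict[OF fin fin])
  also have "\<dots> = (\<Sum>d \<in> {d. (b, d) \<in> r}. (if b = d then N d else 0))"
    using mobius_sum_interval[OF assms(1,2)]
    by (intro sum.cong refl) (simp flip: sum_distrib_right of_int_sum)
  also have "\<dots> = N b"
    using po(1) assms(3) fin by (simp add: refl_on_def)
  finally show ?thesis .
qed

text \<open>By induction from the top.  With \<open>S c = \<Sum>d \<ge> c. M d\<close>, inversion gives
  \<open>M b = \<Sum>c \<ge> b. \<mu>(b, c) S c\<close>.  The defining sum for \<open>M b\<close> has \<open>G c\<close> in place of \<open>S c\<close>; these agree for
  \<open>c > b\<close> by induction, so the terms for \<open>c = b\<close> agree as well.\<close>

lemma mobius_inversion_converse:
  fixes G M :: "'a \<Rightarrow> 'b :: comm_ring_1"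
  assumes "finite r" "partial_order_on A r" "b \<in> A"
    and M: "\<And>b. b \<in> A \<Longrightarrow> M b = (\<Sum>c \<in> {c. (b, c) \<in> r}. of_int (mobius r b c) * G c)"
  shows "G b = (\<Sum>c \<in> {c. (b, c) \<in> r}. M c)"
  using assms(3)
proof (induction b rule: measure_induct_rule[where f = "\<lambda>b. card {c. (b, c) \<in> r}"])
  case (less b)
  have po: "refl_on A r" "trans r" "antisym r" "r \<subseteq> A \<times> A"
    using assms(2) by (auto simp: partial_order_on_def preorder_on_def)
  have fin: "finite {d. (c, d) \<in> r}" for c by (rule finite_above[OF assms(1)])
  have b: "(b, b) \<in> r" using po(1) less.prems by (auto simp: refl_on_def)
  let ?S = "\<lambda>c. \<Sum>d \<in> {d. (c, d) \<in> r}. M d"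
  have IH: "G c = ?S c" if "(b, c) \<in> r" "c \<noteq> b" for c
  proof (rule less.IH)
    have "b \<notin> {d. (c, d) \<in> r}" using that po(3) by (auto dest: antisymD)
    moreover have "{d. (c, d) \<in> r} \<subseteq> {d. (b, d) \<in> r}" using that po(2) by (auto dest: transD)
    ultimately show "card {d. (c, d) \<in> r} < card {d. (b, d) \<in> r}"
      using b fin by (intro psubset_card_mono) auto
    show "c \<in> A" using that po(4) by auto
  qed
  have one: "mobius r b b = 1" by (simp add: mobius.simps[of r b b])
  have split: "(\<Sum>c \<in> {c. (b, c) \<in> r}. of_int (mobius r b c) * H c)
      = H b + (\<Sum>c \<in> {c. (b, c) \<in> r} - {b}. of_int (mobius r b c) * H c)" for H :: "'a \<Rightarrow> 'b"
    using b fin one by (simp add: sum.remove)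
  have "M b = ?S b + (\<Sum>c \<in> {c. (b, c) \<in> r} - {b}. of_int (mobius r b c) * ?S c)"
    using mobius_inversion[OF assms(1,2) less.prems, of M] split[of ?S] by (rule trans[OF sym])
  also have "(\<Sum>c \<in> {c. (b, c) \<in> r} - {b}. of_int (mobius r b c) * ?S c)
      = (\<Sum>c \<in> {c. (b, c) \<in> r} - {b}. of_int (mobius r b c) * G c)"
    using IH by (intro sum.cong) auto
  finally show ?case using M[OF less.prems] split[of G] by simp
qed

section \<open>Splitting and grafting in the Tamari order\<close>

lemma tamari_le_left: "tamari_le l l' \<Longrightarrow> tamari_le (l \<^bold>\<or> r) (l' \<^bold>\<or> r)"
  unfolding tamari_le_def
  by (induction rule: rtranclp_induct) (auto intro: tamari_cover.left rtranclp.rtrancl_into_rtrancl)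

lemma tamari_le_right: "tamari_le r r' \<Longrightarrow> tamari_le (l \<^bold>\<or> r) (l \<^bold>\<or> r')"
  unfolding tamari_le_def
  by (induction rule: rtranclp_induct) (auto intro: tamari_cover.right rtranclp.rtrancl_into_rtrancl)

lemma tamari_le_rotate: "tamari_le ((x \<^bold>\<or> y) \<^bold>\<or> z) (x \<^bold>\<or> (y \<^bold>\<or> z))"
  unfolding tamari_le_def by (intro r_into_rtranclp tamari_cover.rotate)

lemma size_split_tree:
  "i \<le> size t \<Longrightarrow> size (fst (split_tree t i)) = i \<and> size (snd (split_tree t i)) = size t - i"
  by (induction t arbitrary: i) (auto simp: split_beta)

lemma split_tree_0: "split_tree t 0 = (Leaf, t)"
  by (induction t) auto

lemma split_graft: "split_tree (graft_tree c s) (size c) = (c, s)"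
  by (induction c) (auto simp: split_tree_0)

lemma graft_left_mono_cover:
  "tamari_cover c c' \<Longrightarrow> tamari_cover (graft_tree c s) (graft_tree c' s)"
  by (induction rule: tamari_cover.induct) (auto intro: tamari_cover.intros)

lemma graft_left_mono: "tamari_le c c' \<Longrightarrow> tamari_le (graft_tree c s) (graft_tree c' s)"
  unfolding tamari_le_def
  by (induction rule: rtranclp_induct)
     (auto intro: rtranclp.rtrancl_into_rtrancl graft_left_mono_cover)

lemma graft_right_mono: "tamari_le s s' \<Longrightarrow> tamari_le (graft_tree c s) (graft_tree c s')"
  by (induction c) (auto intro: tamari_le_right)

text \<open>Each node on the right spine of \<open>a\<close> costs one rotation, which moves it above the root.\<close>

lemma graft_vee_le: "tamari_le (graft_tree a b \<^bold>\<or> r) (graft_tree a (b \<^bold>\<or> r))"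
proof (induction a)
  case (Node x u y)
  then show ?case
    using tamari_le_trans[OF tamari_le_rotate tamari_le_right] by simp
qed (simp add: tamari_le_refl)

text \<open>Gluing the two halves back together moves the nodes right of the cutting path below those left of
  it.  Each such exchange rotates a node above a parent to its right, which goes up in the Tamari
  order.\<close>

lemma le_graft_split:
  "tamari_le t (graft_tree (fst (split_tree t i)) (snd (split_tree t i)))"
proof (induction t arbitrary: i)
  case (Node l u r)
  show ?case
  proof (cases "i \<le> size l")
    case True
    then show ?thesis
      using tamari_le_trans[OF tamari_le_left[OF Node.IH(1)[of i]] graft_vee_le]
      by (simp add: split_beta)
  next
    case False
    then show ?thesis
      using tamari_le_right[OF Node.IH(2)] by (simp add: split_beta)
  qed
qed (simp add: tamari_le_refl)

text \<open>Cutting a rotation \<open>(x \<or> y) \<or> z \<rightarrow> x \<or> (y \<or> z)\<close> inside \<open>x\<close> or \<open>z\<close> leaves a rotation in one part; cutting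
  it inside \<open>y\<close> separates the two nodes involved and leaves equal parts.\<close>

lemma split_mono_cover:
  "tamari_cover s t \<Longrightarrow> tamari_le (fst (split_tree s i)) (fst (split_tree t i)) \<and>
     tamari_le (snd (split_tree s i)) (snd (split_tree t i))"
proof (induction arbitrary: i rule: tamari_cover.induct)
  case (rotate x y z)
  then show ?case
    by (auto simp: split_beta intro: tamari_le_refl tamari_le_rotate tamari_le_right)
next
  case (left l l' r)
  then show ?case
    using tamari_cover_size[OF left.hyps] tamari_le_left r_into_rtranclp[of tamari_cover l l']
    by (auto simp: split_beta tamari_le_refl simp flip: tamari_le_def)
next
  case (right r r' l)
  then show ?case
    using r_into_rtranclp[of tamari_cover r r'] tamari_le_right
    by (auto simp: split_beta tamari_le_refl simp flip: tamari_le_def)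
qed

lemma split_mono:
  assumes "tamari_le s t"
  shows "tamari_le (fst (split_tree s i)) (fst (split_tree t i)) \<and>
     tamari_le (snd (split_tree s i)) (snd (split_tree t i))"
  using assms unfolding tamari_le_def[THEN fun_cong, THEN fun_cong, of s t]
  by (induction rule: rtranclp_induct)
     (auto intro: tamari_le_refl tamari_le_trans dest: split_mono_cover)

text \<open>The adjunction between splitting and grafting.  It matches the \<open>F\<close>-expansion of the coaction with
  factorizations of the trees above \<open>t\<close>.\<close>

lemma le_graft_iff:
  "tamari_le t (graft_tree c s) \<longleftrightarrow>
     tamari_le (fst (split_tree t (size c))) c \<and> tamari_le (snd (split_tree t (size c))) s"
proof
  assume "tamari_le t (graft_tree c s)"
  from split_mono[OF this, of "size c"]
  show "tamari_le (fst (split_tree t (size c))) c \<and> tamari_le (snd (split_tree t (size c))) s"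
    by (simp add: split_graft)
next
  assume "tamari_le (fst (split_tree t (size c))) c \<and> tamari_le (snd (split_tree t (size c))) s"
  then show "tamari_le t (graft_tree c s)"
    by (meson graft_left_mono graft_right_mono le_graft_split tamari_le_trans)
qed

section \<open>Node posets of split and grafted trees\<close>

lemma node_edges_Node:
  "(i, j) \<in> node_edges (l \<^bold>\<or> r) \<longleftrightarrow>
     l \<noteq> Leaf \<and> i = root_node l \<and> j = Suc (size l) \<or>
     r \<noteq> Leaf \<and> i = Suc (size l) + root_node r \<and> j = Suc (size l) \<or>
     (i, j) \<in> node_edges l \<or>
     (\<exists>i' j'. i = Suc (size l) + i' \<and> j = Suc (size l) + j' \<and> (i', j') \<in> node_edges r)"
  by (auto simp: Let_def image_iff) force+

declare node_edges.simps(2) [simp del]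

lemma root_node_bounds: "t \<noteq> Leaf \<Longrightarrow> root_node t \<in> {1..size t}"
  by (cases t) (auto simp: root_node_def)

lemma node_edges_bounds: "(i, j) \<in> node_edges t \<Longrightarrow> i \<in> {1..size t} \<and> j \<in> {1..size t}"
proof (induction t arbitrary: i j)
  case (Node l u r)
  then show ?case
    using root_node_bounds[of l] root_node_bounds[of r] by (fastforce simp: node_edges_Node)
qed simp

lemma node_le_refl: "node_le t i i"
  by (simp add: node_le_def)

lemma node_le_trans: "node_le t i j \<Longrightarrow> node_le t j k \<Longrightarrow> node_le t i k"
  unfolding node_le_def by (rule rtrancl_trans)

lemma node_le_edge: "(i, j) \<in> node_edges t \<Longrightarrow> node_le t i j"
  by (simp add: node_le_def)

lemma node_le_left: "node_le l i j \<Longrightarrow> node_le (l \<^bold>\<or> r) i j"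
  unfolding node_le_def by (erule rtrancl_mono[THEN subsetD, rotated]) (auto simp: node_edges_Node)

lemma node_le_right:
  assumes "node_le r i j"
  shows "node_le (l \<^bold>\<or> r) (Suc (size l) + i) (Suc (size l) + j)"
  using assms unfolding node_le_def
proof (induction rule: rtrancl_induct)
  case (step y z)
  have "(Suc (size l) + y, Suc (size l) + z) \<in> node_edges (l \<^bold>\<or> r)"
    using step.hyps(2) by (auto simp: node_edges_Node)
  then show ?case using step.IH by (rule rtrancl_into_rtrancl[rotated])
qed simp

lemma node_le_root: "i \<in> {1..size t} \<Longrightarrow> node_le t i (root_node t)"
proof (induction t arbitrary: i)
  case (Node l u r)
  consider "i \<in> {1..size l}" | "i = Suc (size l)" | "i - Suc (size l) \<in> {1..size r}" "i > Suc (size l)"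
    using Node.prems by fastforce
  then show ?case
  proof cases
    case 1
    then have "node_le (l \<^bold>\<or> r) (root_node l) (Suc (size l))"
      by (intro node_le_edge) (auto simp: node_edges_Node)
    with node_le_left[OF Node.IH(1)[OF 1], of r] have "node_le (l \<^bold>\<or> r) i (Suc (size l))"
      by (rule node_le_trans)
    then show ?thesis by (simp add: root_node_def)
  next
    case 2
    then show ?thesis by (simp add: root_node_def node_le_refl)
  next
    case 3
    then have "node_le (l \<^bold>\<or> r) (Suc (size l) + root_node r) (Suc (size l))"
      by (intro node_le_edge) (auto simp: node_edges_Node)
    moreover have "node_le (l \<^bold>\<or> r) i (Suc (size l) + root_node r)"
      using node_le_right[OF Node.IH(2)[OF 3(1)], of l] 3 by simp
    ultimately have "node_le (l \<^bold>\<or> r) i (Suc (size l))" by (metis node_le_trans)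
    then show ?thesis by (simp add: root_node_def)
  qed
qed simp

text \<open>The parent of a node of the left part is its nearest ancestor in \<open>t\<close> that lies left of the cut.  Hence
  the left part inherits its order from \<open>t\<close>, and restricting an order ideal of \<open>t\<close> to it gives an
  order ideal again.\<close>

lemma node_le_split:
  assumes "k \<le> size t" "node_le (fst (split_tree t k)) i j"
  shows "node_le t i j"
proof -
  have edge: "k \<le> size t \<Longrightarrow> (i, j) \<in> node_edges (fst (split_tree t k)) \<Longrightarrow> node_le t i j" for i j
  proof (induction t arbitrary: k i j)
    case (Node l u r)
    show ?case
    proof (cases "k \<le> size l")
      case True
      with Node show ?thesis by (auto simp: split_beta intro: node_le_left)
    next
      case False
      let ?k = "k - Suc (size l)"
      let ?r0 = "fst (split_tree r ?k)"
      have k: "?k \<le> size r" using Node.prems by simp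
      have "(i, j) \<in> node_edges (l \<^bold>\<or> ?r0)" using Node.prems False by (simp add: split_beta)
      then consider "(i, j) \<in> node_edges (l \<^bold>\<or> Leaf)"
        | "i = Suc (size l) + root_node ?r0" "j = Suc (size l)" "?r0 \<noteq> Leaf"
        | i' j' where "i = Suc (size l) + i'" "j = Suc (size l) + j'" "(i', j') \<in> node_edges ?r0"
        by (auto simp: node_edges_Node)
      then show ?thesis
      proof cases
        case 1
        then have "(i, j) \<in> node_edges (l \<^bold>\<or> r)" by (auto simp: node_edges_Node)
        then show ?thesis by (auto intro: node_le_edge)
      next
        case 2
        have "root_node ?r0 \<in> {1..size ?r0}" using 2(3) by (rule root_node_bounds)
        then have "root_node ?r0 \<in> {1..size r}" using size_split_tree[OF k] k by auto
        then have "Suc (size l) + root_node ?r0 \<in> {1..size (l \<^bold>\<or> r)}" by auto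
        from node_le_root[OF this] 2 show ?thesis by (simp add: root_node_def)
      next
        case 3
        from node_le_right[OF Node.IH(2)[OF k 3(3)]] 3 show ?thesis by simp
      qed
    qed
  qed simp
  show ?thesis
    using assms(2) unfolding node_le_def[of "fst _"]
    by (induction rule: rtrancl_induct) (auto intro: node_le_refl node_le_trans edge[OF assms(1)])
qed

text \<open>Grafting attaches the new nodes below old ones, so no edge leads from an old node to a new one.\<close>

lemma node_edges_graft:
  "(i, j) \<in> node_edges (graft_tree c s) \<Longrightarrow> i \<le> size c \<Longrightarrow> (i, j) \<in> node_edges c"
proof (induction c arbitrary: i j)
  case Leaf
  then show ?case using node_edges_bounds by fastforce
next
  case (Node l u r)
  from Node.prems consider "(i, j) \<in> node_edges (l \<^bold>\<or> Leaf)"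
    | "i = Suc (size l) + root_node (graft_tree r s)" "j = Suc (size l)" "graft_tree r s \<noteq> Leaf"
    | i' j' where "i = Suc (size l) + i'" "j = Suc (size l) + j'" "(i', j') \<in> node_edges (graft_tree r s)"
    by (auto simp: node_edges_Node)
  then show ?case
  proof cases
    case 1
    then show ?thesis by (auto simp: node_edges_Node)
  next
    case 2
    have "r \<noteq> Leaf" using 2 Node.prems(2) by (auto simp: root_node_def)
    then show ?thesis using 2 by (cases r) (auto simp: node_edges_Node root_node_def)
  next
    case 3
    then have "(i', j') \<in> node_edges r" using Node.IH(2) Node.prems(2) by simp
    with 3 show ?thesis by (auto simp: node_edges_Node)
  qed
qed

lemma node_le_graft:
  assumes "node_le (graft_tree c s) i j" "i \<in> {1..size c}"
  shows "node_le c i j \<and> j \<in> {1..size c}"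
  using assms(1) unfolding node_le_def[of "graft_tree _ _"]
proof (induction rule: rtrancl_induct)
  case base
  then show ?case using assms by (simp add: node_le_refl)
next
  case (step y z)
  then have "(y, z) \<in> node_edges c" by (auto intro: node_edges_graft)
  then show ?case using step.IH node_edges_bounds by (blast intro: node_le_trans node_le_edge)
qed

lemma bileveled_graft:
  assumes "c \<in> bileveled p" "s \<in> Ytrees q" "p \<ge> 1"
  shows "graft c s \<in> bileveled (p + q)"
proof -
  obtain c' C where c: "c = (c', C)" by force
  have C: "size c' = p" "size s = q" "C \<subseteq> {1..p}" "\<forall>i \<in> C. \<forall>j. node_le c' i j \<longrightarrow> j \<in> C"
     "1 \<in> C" "\<forall>i \<in> C. node_le c' i 1 \<longrightarrow> i = 1"
    using assms by (auto simp: bileveled_def Ytrees_def c)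
  have *: "node_le c' i j" if "node_le (graft_tree c' s) i j" "i \<in> C" for i j
    using node_le_graft[OF that(1)] that(2) C by auto
  show ?thesis
    using C * by (auto simp: bileveled_def graft_def c Ytrees_def size_graft_tree)
qed

lemma bileveled_split:
  assumes "(t, T) \<in> bileveled n" "i \<le> n"
  shows "(fst (split_tree t i), T \<inter> {1..i}) \<in> bileveled i"
proof -
  have T: "size t = n" "T \<subseteq> {1..n}" "\<forall>i \<in> T. \<forall>j. node_le t i j \<longrightarrow> j \<in> T"
     "n \<noteq> 0 \<Longrightarrow> 1 \<in> T" "n \<noteq> 0 \<Longrightarrow> \<forall>i \<in> T. node_le t i 1 \<longrightarrow> i = 1"
    using assms by (auto simp: bileveled_def Ytrees_def)
  let ?t = "fst (split_tree t i)"
  have sz: "size ?t = i" using size_split_tree[of i t] assms T by simp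
  have le: "node_le t j k" if "node_le ?t j k" for j k using node_le_split that T assms by auto
  have "k \<in> {1..i}" if "node_le ?t j k" "j \<in> {1..i}" for j k
    using that unfolding node_le_def
    by (induction rule: rtrancl_induct) (use node_edges_bounds sz in fastforce)+
  then show ?thesis
    using T le assms(2) sz by (auto simp: bileveled_def Ytrees_def)
qed

section \<open>The left spine\<close>

text \<open>The nodes on the path from node 1 to the root, i.e. the principal upper ideal of node 1.\<close>

fun left_spine :: "pbt \<Rightarrow> nat set" where
  "left_spine Leaf = {}"
| "left_spine (Node l u r) = insert (Suc (size l)) (left_spine l)"

lemma left_spine_bounds: "left_spine t \<subseteq> {1..size t}"
  by (induction t) fastforce+

lemma one_in_left_spine: "t \<noteq> Leaf \<Longrightarrow> 1 \<in> left_spine t"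
proof (induction t)
  case (Node l u r)
  then show ?case by (cases "l = Leaf") auto
qed simp

text \<open>Along the left spine, going up means going right.  Hence nothing in it lies strictly below node 1,
  as a bi-leveled tree requires.\<close>

lemma left_spine_edge:
  "(i, j) \<in> node_edges t \<Longrightarrow> i \<in> left_spine t \<Longrightarrow> j \<in> left_spine t \<and> i < j"
proof (induction t arbitrary: i j)
  case (Node l u r)
  have edge: "(i, j) \<in> node_edges (l \<^bold>\<or> r)" using Node.prems(1) by simp
  have spine: "i = Suc (size l) \<or> i \<in> left_spine l" using Node.prems(2) by simp
  then have i: "1 \<le> i" "i \<le> Suc (size l)" using left_spine_bounds[of l] by auto
  consider "l \<noteq> Leaf" "i = root_node l" "j = Suc (size l)"
    | "i = Suc (size l) + root_node r" "r \<noteq> Leaf"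
    | "(i, j) \<in> node_edges l"
    | i' j' where "i = Suc (size l) + i'" "(i', j') \<in> node_edges r"
    using edge unfolding node_edges_Node by blast
  then show ?case
  proof cases
    case 1
    then show ?thesis using root_node_bounds[of l] by simp
  next
    case 2
    then show ?thesis using i by (simp add: root_node_def)
  next
    case 3
    then have "i \<in> left_spine l" using spine node_edges_bounds[OF 3] by auto
    then show ?thesis using Node.IH(1)[OF 3] by simp
  next
    case 4
    then show ?thesis using i node_edges_bounds[OF 4(2)] by auto
  qed
qed simp

lemma left_spine_upper:
  assumes "node_le t i j" "i \<in> left_spine t"
  shows "j \<in> left_spine t \<and> i \<le> j"
  using assms unfolding node_le_def
  by (induction rule: rtrancl_induct) (auto dest: left_spine_edge)

lemma left_spine_above_one: "j \<in> left_spine t \<Longrightarrow> node_le t 1 j"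
proof (induction t)
  case (Node l u r)
  show ?case
  proof (cases "l = Leaf")
    case True
    then show ?thesis using Node.prems by (simp add: node_le_refl)
  next
    case False
    then have "1 \<in> {1..size (l \<^bold>\<or> r)}" by simp
    from node_le_root[OF this] show ?thesis
      using Node by (auto simp: root_node_def intro: node_le_left)
  qed
qed simp

lemma bileveled_left_spine: "(t, left_spine t) \<in> bileveled (size t)"
proof -
  have "i = 1" if "i \<in> left_spine t" "node_le t i 1" for i
    using left_spine_upper[OF that(2,1)] left_spine_bounds[of t] that(1) by auto
  then show ?thesis
    using left_spine_bounds[of t] one_in_left_spine[of t] left_spine_upper
    by (auto simp: bileveled_def Ytrees_def eq_size_0)
qed

lemma left_spine_subset:
  assumes "(t, T) \<in> bileveled n"
  shows "left_spine t \<subseteq> T"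
proof (cases "t = Leaf")
  case False
  then have "n \<noteq> 0" using assms by (auto simp: bileveled_def Ytrees_def)
  then show ?thesis using assms left_spine_above_one by (fastforce simp: bileveled_def)
qed simp

text \<open>A rotation on the left spine pushes its upper node into the right subtree of the lower one; all
  other rotations preserve the left spine.\<close>

lemma left_spine_antimono_cover: "tamari_cover s t \<Longrightarrow> left_spine t \<subseteq> left_spine s"
  by (induction rule: tamari_cover.induct) (auto dest: tamari_cover_size)

lemma left_spine_antimono: "tamari_le s t \<Longrightarrow> left_spine t \<subseteq> left_spine s"
  unfolding tamari_le_def
  by (induction rule: rtranclp_induct) (auto dest: left_spine_antimono_cover)

section \<open>The maximum of a fiber\<close>

lemma standardize_map:
  assumes "strict_mono_on (set w) f"
  shows "standardize (map f w) = standardize w"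
proof -
  have "card {b \<in> f ` set w. b \<le> f a} = card {b \<in> set w. b \<le> a}" if "a \<in> set w" for a
  proof -
    have "{b \<in> f ` set w. b \<le> f a} = f ` {b \<in> set w. b \<le> a}"
      using strict_mono_on_leD[OF assms] strict_mono_onD[OF assms] that
      by (auto simp: image_iff) (metis linorder_not_le)
    moreover have "inj_on f {b \<in> set w. b \<le> a}"
      by (rule inj_on_subset[OF strict_mono_on_imp_inj_on[OF assms]]) auto
    ultimately show ?thesis by (simp add: card_image)
  qed
  then show ?thesis by (simp add: standardize_def)
qed

lemma tau_standardize_append:
  assumes "\<forall>x \<in> set u \<union> set v. x < m"
  shows "tau (u @ m # v) = tau (standardize u) \<^bold>\<or> tau (standardize v)"
proof -
  have m: "Max (set (u @ m # v)) = m" using assms by (intro Max_eqI) (auto intro: less_imp_le)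
  have t: "takeWhile (\<lambda>a. a \<noteq> m) (u @ m # v) = u" "dropWhile (\<lambda>a. a \<noteq> m) (u @ m # v) = m # v"
    using assms by (auto simp: takeWhile_append dropWhile_append)
  show ?thesis by (subst tau.simps) (simp only: m t Let_def, simp)
qed

lemma split_at_max:
  assumes "distinct w" "w \<noteq> []"
  obtains u m v where "w = u @ m # v" "\<forall>x \<in> set u \<union> set v. x < (m :: nat)"
proof -
  have "Max (set w) \<in> set w" using assms by simp
  then obtain u v where w: "w = u @ Max (set w) # v" by (meson split_list)
  have "x < Max (set w)" if "x \<in> set u \<union> set v" for x
  proof -
    have "x \<in> set w" using that by (subst w) auto
    then have "x \<le> Max (set w)" by simp
    moreover have "x \<noteq> Max (set w)" using that assms(1) by (subst (asm) w) auto
    ultimately show ?thesis by simp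
  qed
  then show ?thesis using w that by blast
qed

text \<open>\<open>\<tau>\<close> sees only the relative order of the letters.  This removes the standardizations from its
  recursion, so that \<open>\<tau>\<close> can be treated as a function of arbitrary words with distinct letters.\<close>

lemma tau_map:
  assumes "strict_mono_on (set w) f" "distinct w"
  shows "tau (map f w) = tau w"
proof (cases "w = []")
  case False
  then obtain u m v where w: "w = u @ m # v" "\<forall>x \<in> set u \<union> set v. x < m"
    using split_at_max assms(2) by blast
  then have "\<forall>x \<in> set (map f u) \<union> set (map f v). x < f m"
    using strict_mono_onD[OF assms(1)] by auto
  moreover have "strict_mono_on (set u) f" "strict_mono_on (set v) f"
    by (rule monotone_on_subset[OF assms(1)]; simp add: w subset_insertI2)+
  ultimately show ?thesis
    using w by (simp add: tau_standardize_append standardize_map)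
qed simp

lemma tau_standardize: "distinct w \<Longrightarrow> tau (standardize w) = tau w"
  unfolding standardize_def
proof (rule tau_map)
  show "strict_mono_on (set w) (\<lambda>a. card {b \<in> set w. b \<le> a})"
  proof (intro strict_mono_onI psubset_card_mono psubsetI)
    fix r s assume "r \<in> set w" "s \<in> set w" "r < s"
    then have "s \<in> {b \<in> set w. b \<le> s}" "s \<notin> {b \<in> set w. b \<le> r}" by auto
    then show "{b \<in> set w. b \<le> r} \<noteq> {b \<in> set w. b \<le> s}" by blast
  qed auto
qed

lemma tau_append:
  assumes "distinct (u @ m # v)" "\<forall>x \<in> set u \<union> set v. x < m"
  shows "tau (u @ m # v) = tau u \<^bold>\<or> tau v"
  using tau_standardize_append[OF assms(2)] tau_standardize assms(1) by simp

lemma size_tau: "distinct w \<Longrightarrow> size (tau w) = length w"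
proof (induction w rule: length_induct)
  case (1 w)
  show ?case
  proof (cases "w = []")
    case True
    then show ?thesis by (simp add: tau.simps)
  next
    case False
    then obtain u m v where w: "w = u @ m # v" "\<forall>x \<in> set u \<union> set v. x < m"
      using split_at_max 1 by blast
    moreover have "size (tau u) = length u" "size (tau v) = length v"
      using 1 w by auto
    ultimately show ?thesis using 1 by (simp add: tau_append)
  qed
qed

text \<open>Swapping \<open>k\<close> and \<open>k + 1\<close> stays in the fiber when a larger letter stands between them: in the recursion
  for \<open>\<tau>\<close> a larger letter between them becomes a root before either of the two does, and once they lie
  in different parts the swap preserves the relative order within each part.\<close>

lemma tau_swap:
  assumes "distinct (p @ k # q @ Suc k # z)" "m \<in> set q" "Suc k < m"
  shows "tau (p @ Suc k # q @ k # z) = tau (p @ k # q @ Suc k # z)"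
  using assms
proof (induction "length (p @ z)" arbitrary: p z rule: less_induct)
  case less
  let ?w = "p @ k # q @ Suc k # z"
  let ?w' = "p @ Suc k # q @ k # z"
  obtain u M v where w: "?w = u @ M # v" "\<forall>x \<in> set u \<union> set v. x < M"
    using split_at_max[OF less.prems(1)] by blast
  have all_le: "\<forall>x \<in> set ?w. x \<le> M" unfolding w(1) using w(2) by (auto intro: less_imp_le)
  have M_in: "M \<in> set ?w" unfolding w(1) by simp
  have "m \<le> M" using all_le less.prems(2) by simp
  then have M: "M \<noteq> k" "M \<noteq> Suc k" "Suc k < M" using less.prems(3) by auto
  have d': "distinct ?w'" using less.prems(1) by auto
  have lt: "\<forall>x \<in> set ?w. x \<noteq> M \<longrightarrow> x < M" using all_le le_neq_implies_less by blast
  from M_in M consider "M \<in> set p" | "M \<in> set q" | "M \<in> set z" by auto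
  then show ?case
  proof cases
    case 1
    then obtain p1 p2 where p: "p = p1 @ M # p2" by (meson split_list)
    have d: "distinct (p1 @ M # (p2 @ k # q @ Suc k # z))"
      "distinct (p1 @ M # (p2 @ Suc k # q @ k # z))" using less.prems(1) p by auto
    have IH: "tau (p2 @ Suc k # q @ k # z) = tau (p2 @ k # q @ Suc k # z)"
      using less.hyps[of p2 z] less.prems p by auto
    have "\<forall>x \<in> set p1 \<union> set (p2 @ k # q @ Suc k # z). x < M"
      using lt d(1) unfolding p by auto
    moreover have "\<forall>x \<in> set p1 \<union> set (p2 @ Suc k # q @ k # z). x < M"
      using calculation by auto
    ultimately show ?thesis
      using tau_append[OF d(1)] tau_append[OF d(2)] IH p by simp
  next
    case 2
    then obtain q1 q2 where q: "q = q1 @ M # q2" by (meson split_list)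
    have d: "distinct ((p @ k # q1) @ M # (q2 @ Suc k # z))"
      "distinct ((p @ Suc k # q1) @ M # (q2 @ k # z))" using less.prems(1) q by auto
    have lt1: "\<forall>x \<in> set (p @ k # q1) \<union> set (q2 @ Suc k # z). x < M"
      using lt d(1) unfolding q by auto
    have lt2: "\<forall>x \<in> set (p @ Suc k # q1) \<union> set (q2 @ k # z). x < M"
      using lt1 M(3) by auto
    \<comment> \<open>The root separates the two letters; on each side the swap is a strictly monotone relabelling.\<close>
    let ?f = "\<lambda>x. if x = k then Suc k else x"
    let ?g = "\<lambda>x. if x = Suc k then k else x"
    have "map ?f (p @ k # q1) = p @ Suc k # q1" using d(1) by (auto intro!: map_idI)
    moreover have "strict_mono_on (set (p @ k # q1)) ?f"
      using d(2) by (intro strict_mono_onI) (auto intro: Suc_lessI)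
    moreover have "distinct (p @ k # q1)" using d(1) by auto
    ultimately have 1: "tau (p @ Suc k # q1) = tau (p @ k # q1)"
      using tau_map[of "p @ k # q1" ?f] by presburger
    have "map ?g (q2 @ Suc k # z) = q2 @ k # z" using d(1) by (auto intro!: map_idI)
    moreover have "strict_mono_on (set (q2 @ Suc k # z)) ?g"
      using d(2) by (intro strict_mono_onI) (auto simp: less_Suc_eq)
    moreover have "distinct (q2 @ Suc k # z)" using d(1) by auto
    ultimately have 2: "tau (q2 @ k # z) = tau (q2 @ Suc k # z)"
      using tau_map[of "q2 @ Suc k # z" ?g] by presburger
    show ?thesis
      using tau_append[OF d(1) lt1] tau_append[OF d(2) lt2] 1 2 q by simp
  next
    case 3
    then obtain z1 z2 where z: "z = z1 @ M # z2" by (meson split_list)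
    have d: "distinct ((p @ k # q @ Suc k # z1) @ M # z2)"
      "distinct ((p @ Suc k # q @ k # z1) @ M # z2)" using less.prems(1) z by auto
    have IH: "tau (p @ Suc k # q @ k # z1) = tau (p @ k # q @ Suc k # z1)"
      using less.hyps[of p z1] less.prems z by auto
    have "\<forall>x \<in> set (p @ k # q @ Suc k # z1) \<union> set z2. x < M"
      using lt d(1) unfolding z by auto
    moreover have "\<forall>x \<in> set (p @ Suc k # q @ k # z1) \<union> set z2. x < M"
      using calculation by auto
    ultimately show ?thesis
      using tau_append[OF d(1)] tau_append[OF d(2)] IH z by simp
  qed
qed

text \<open>The letters \<open>a\<close> and \<open>c\<close> are the 1 and the 2 of an occurrence of the pattern 132.\<close>

definition pattern_132 :: "nat list \<Rightarrow> nat \<Rightarrow> nat \<Rightarrow> bool" where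
  "pattern_132 w a c \<longleftrightarrow> a < c \<and> (\<exists>p q z. w = p @ a # q @ c # z \<and> (\<exists>m \<in> set q. c < m))"

text \<open>In an occurrence with \<open>c - a\<close> minimal the letters are adjacent in value: otherwise the letter \<open>a + 1\<close>
  can replace \<open>a\<close> if it stands left of the letter that plays the 3, and \<open>c\<close> if it stands right of it.
  So any permutation that contains the pattern admits a swap that moves it up within its fiber.\<close>

lemma pattern_132_adjacent:
  assumes "w \<in> permutations_of_set {1..n}" "pattern_132 w a c"
  shows "\<exists>k. pattern_132 w k (Suc k)"
  using assms(2)
proof (induction "c - a" arbitrary: a c rule: less_induct)
  case less
  show ?case
  proof (cases "c = Suc a")
    case False
    from less.prems obtain p q z m where w: "w = p @ a # q @ c # z" "m \<in> set q" "c < m" and "a < c"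
      by (auto simp: pattern_132_def)
    have sw: "set w = {1..n}" using assms(1) by (simp add: permutations_of_set_def)
    obtain q1 q2 where q: "q = q1 @ m # q2" using w by (meson split_list)
    have "a \<in> set w" "c \<in> set w" using w by auto
    then have "Suc a \<in> set w" using \<open>a < c\<close> unfolding sw by auto
    moreover have "Suc a \<noteq> m" using w(3) \<open>a < c\<close> by simp
    ultimately consider "Suc a \<in> set p" | "Suc a \<in> set q1" | "Suc a \<in> set q2" | "Suc a \<in> set z"
      using False unfolding w(1) q by auto
    then have "pattern_132 w (Suc a) c \<or> pattern_132 w a (Suc a)"
    proof cases
      case 1
      then obtain p1 p2 where "p = p1 @ Suc a # p2" by (meson split_list)
      then have "w = p1 @ Suc a # (p2 @ a # q) @ c # z" using w by simp
      moreover have "m \<in> set (p2 @ a # q)" using w(2) by simp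
      ultimately have "pattern_132 w (Suc a) c"
        using w(3) Suc_lessI[OF \<open>a < c\<close>] False unfolding pattern_132_def by blast
      then show ?thesis ..
    next
      case 2
      then obtain p1 p2 where "q1 = p1 @ Suc a # p2" by (meson split_list)
      then have "w = (p @ a # p1) @ Suc a # (p2 @ m # q2) @ c # z" using w q by simp
      moreover have "m \<in> set (p2 @ m # q2)" by simp
      ultimately have "pattern_132 w (Suc a) c"
        using w(3) Suc_lessI[OF \<open>a < c\<close>] False unfolding pattern_132_def by blast
      then show ?thesis ..
    next
      case 3
      then obtain p1 p2 where "q2 = p1 @ Suc a # p2" by (meson split_list)
      then have "w = p @ a # (q1 @ m # p1) @ Suc a # (p2 @ c # z)" using w q by simp
      moreover have "m \<in> set (q1 @ m # p1)" "Suc a < m" using w(3) \<open>a < c\<close> by simp_all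
      ultimately have "pattern_132 w a (Suc a)" unfolding pattern_132_def by blast
      then show ?thesis ..
    next
      case 4
      then obtain p1 p2 where "z = p1 @ Suc a # p2" by (meson split_list)
      then have "w = p @ a # (q @ c # p1) @ Suc a # p2" using w q by simp
      moreover have "m \<in> set (q @ c # p1)" "Suc a < m" using w \<open>a < c\<close> by simp_all
      ultimately have "pattern_132 w a (Suc a)" unfolding pattern_132_def by blast
      then show ?thesis ..
    qed
    then show ?thesis
      using less.hyps[of c "Suc a"] \<open>a < c\<close> by auto
  qed (use less.prems in blast)
qed

text \<open>The 132-avoiding word of the fiber, built from the tree: left of the largest letter stand the larger
  of the remaining letters, right of it the smaller ones.\<close>

fun max_word :: "pbt \<Rightarrow> nat list" where
  "max_word Leaf = []"
| "max_word (Node l u r) = map ((+) (size r)) (max_word l) @ Suc (size l + size r) # max_word r"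

lemma max_word_permutation: "max_word t \<in> permutations_of_set {1..size t}"
proof (induction t)
  case (Node l u r)
  then have s: "set (max_word l) = {1..size l}" "set (max_word r) = {1..size r}"
    "distinct (max_word l)" "distinct (max_word r)" by (auto simp: permutations_of_set_def)
  have "(+) (size r) ` {1..size l} = {Suc (size r)..size r + size l}" by simp
  then show ?case
    using s by (auto simp: permutations_of_set_def distinct_map)
qed (simp add: permutations_of_set_def)

lemma length_max_word: "length (max_word t) = size t"
  by (induction t) auto

lemma set_max_word: "set (max_word t) = {1..size t}"
  using max_word_permutation[of t] by (simp add: permutations_of_set_def)

lemma distinct_max_word: "distinct (max_word t)"
  using max_word_permutation[of t] by (simp add: permutations_of_set_def)

lemma tau_max_word: "tau (max_word t) = t"
proof (induction t)
  case Leaf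
  then show ?case by (simp add: tau.simps)
next
  case (Node l u r)
  have "distinct (max_word (l \<^bold>\<or> r))" by (rule distinct_max_word)
  moreover have "tau (map ((+) (size r)) (max_word l)) = l"
    using tau_map[of "max_word l" "(+) (size r)"] Node.IH(1) distinct_max_word
    by (simp add: strict_mono_onI)
  moreover have "\<forall>x \<in> set (map ((+) (size r)) (max_word l)) \<union> set (max_word r).
      x < Suc (size l + size r)"
    by (auto simp: set_max_word)
  ultimately show ?case
    using Node.IH(2) by (simp add: tau_append del: Un_iff set_map)
qed

text \<open>If the left subtree is empty, the word starts with its largest letter and only the root qualifies.
  Otherwise the first letter belongs to the left subtree; the root and some nodes of that subtree are
  at least as large, while everything to the right of the root is smaller.\<close>

lemma beta_max_word: "beta (max_word t) = (t, left_spine t)"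
proof -
  have "{i \<in> {1..size t}. max_word t ! 0 \<le> max_word t ! (i - 1)} = left_spine t"
  proof (induction t)
    case (Node l u r)
    let ?w = "max_word (Node l u r)"
    have r: "max_word r ! j \<le> size r" if "j < size r" for j
      using nth_mem[of j "max_word r"] that set_max_word[of r] by (auto simp: length_max_word)
    have l: "max_word l ! j \<le> size l" "1 \<le> max_word l ! j" if "j < size l" for j
      using nth_mem[of j "max_word l"] that set_max_word[of l] by (auto simp: length_max_word)
    have first: "?w ! 0 = (if l = Leaf then Suc (size l + size r) else size r + max_word l ! 0)"
      by (auto simp: nth_append length_max_word eq_size_0)
    have "i \<in> {1..size (Node l u r)} \<and> ?w ! 0 \<le> ?w ! (i - 1) \<longleftrightarrow> i \<in> left_spine (Node l u r)" for i
    proof -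
      consider "i = 0" | "i \<in> {1..size l}" | "i = Suc (size l)"
        | "i \<in> {size l + 2..size (Node l u r)}" | "i > size (Node l u r)"
        by fastforce
      then show ?thesis
      proof cases
        case 1
        then show ?thesis using left_spine_bounds[of "Node l u r"] by auto
      next
        case 2
        then have "?w ! (i - 1) = size r + max_word l ! (i - 1)"
          by (auto simp: nth_append length_max_word)
        then show ?thesis using 2 first Node.IH(1) by auto
      next
        case 3
        then have "?w ! (i - 1) = Suc (size l + size r)"
          by (simp add: nth_append length_max_word)
        then show ?thesis using 3 first l(1)[of 0] by (cases l) auto
      next
        case 4
        then obtain j where j: "i = size l + 2 + j" "j < size r"
          by (auto dest!: le_Suc_ex)
        then have "?w ! (i - 1) = max_word r ! j"
          by (simp add: nth_append length_max_word)
        then show ?thesis using j first l(2)[of 0] r[OF j(2)] left_spine_bounds[of l]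
          by (cases l) auto
      next
        case 5
        then show ?thesis using left_spine_bounds[of "Node l u r"] by auto
      qed
    qed
    then show ?case by blast
  qed simp
  then show ?thesis by (simp add: beta_def tau_max_word length_max_word)
qed

lemma downward_closed_eq:
  assumes "finite A" "0 \<notin> A" "\<And>x y. y \<in> A \<Longrightarrow> 1 \<le> x \<Longrightarrow> x \<le> y \<Longrightarrow> x \<in> A"
  shows "A = {1..card A}"
proof (cases "A = {}")
  case False
  have "A = {1..Max A}"
  proof
    show "A \<subseteq> {1..Max A}" using assms(1,2) by (auto simp: Suc_le_eq intro: gr0I)
    show "{1..Max A} \<subseteq> A" using assms(3) Max_in[OF assms(1) False] by auto
  qed
  then show ?thesis by (metis card_atLeastAtMost diff_Suc_1 One_nat_def)
qed simp

text \<open>If the pattern is absent, each letter left of the largest letter exceeds each letter right of it.  The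
  sizes of the subtrees then determine which letters stand on which side.\<close>

lemma avoids_132_eq_max_word:
  assumes "w \<in> permutations_of_set {1..size t}" "tau w = t" "\<And>a c. \<not> pattern_132 w a c"
  shows "w = max_word t"
  using assms
proof (induction t arbitrary: w)
  case Leaf
  then show ?case by (auto simp: permutations_of_set_def)
next
  case (Node l x r)
  have sw: "set w = {1..size (l \<^bold>\<or> r)}" and d: "distinct w"
    using Node.prems(1) by (auto simp: permutations_of_set_def)
  have "w \<noteq> []" using sw by auto
  then obtain u M v where w: "w = u @ M # v" "\<forall>x \<in> set u \<union> set v. x < M"
    using split_at_max[OF d] by blast
  have du: "distinct u" "distinct v" "set u \<inter> set v = {}" using d w by auto
  have tuv: "tau u = l" "tau v = r"
    using Node.prems(2) d w by (auto simp: tau_append)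
  have len: "length u = size l" "length v = size r"
    using size_tau[OF du(1)] size_tau[OF du(2)] tuv by auto
  have M: "M = Suc (size l + size r)"
  proof -
    have "Max (set w) = M" using w by (intro Max_eqI) (auto intro: less_imp_le)
    moreover have "Max {1..size (l \<^bold>\<or> r)} = size (l \<^bold>\<or> r)" by (intro Max_eqI) auto
    ultimately show ?thesis unfolding sw by simp
  qed
  have below: "c < a" if ac_in: "a \<in> set u" "c \<in> set v" for a c
  proof (rule ccontr)
    assume "\<not> c < a"
    moreover have "a \<noteq> c" using that du by auto
    ultimately have ac: "a < c" by simp
    obtain p q where u: "u = p @ a # q" using split_list[OF ac_in(1)] by blast
    obtain q' z where v: "v = q' @ c # z" using split_list[OF ac_in(2)] by blast
    have "w = p @ a # (q @ M # q') @ c # z" using w u v by simp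
    moreover have "c < M" "M \<in> set (q @ M # q')" using w that by auto
    ultimately have "pattern_132 w a c" unfolding pattern_132_def using ac by blast
    then show False using Node.prems(3) by blast
  qed
  have un: "set u \<union> set v = {1..size l + size r}"
  proof -
    have "set u \<union> set v = set w - {M}" using d w by auto
    also have "\<dots> = {1..size l + size r}" unfolding sw M by auto
    finally show ?thesis .
  qed
  have sv: "set v = {1..size r}"
  proof -
    have "set v = {1..card (set v)}"
    proof (rule downward_closed_eq)
      show "0 \<notin> set v" using eqset_imp_iff[OF un, of 0] by simp
      fix x y assume "y \<in> set v" "1 \<le> x" "x \<le> y"
      moreover from this have "y \<le> size l + size r" using eqset_imp_iff[OF un, of y] by simp
      ultimately have "x \<in> set u \<union> set v" unfolding un by simp
      then show "x \<in> set v" using below \<open>y \<in> set v\<close> \<open>x \<le> y\<close> by fastforce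
    qed simp
    then show ?thesis using distinct_card[OF du(2)] len by simp
  qed
  have su: "set u = {Suc (size r)..size l + size r}"
  proof -
    have "set u = (set u \<union> set v) - set v" using du(3) by blast
    also have "\<dots> = {Suc (size r)..size l + size r}" unfolding un unfolding sv by auto
    finally show ?thesis .
  qed
  have v: "v = max_word r"
  proof (rule Node.IH(2))
    show "v \<in> permutations_of_set {1..size r}" using sv du by (simp add: permutations_of_set_def)
    show "\<not> pattern_132 v a c" for a c
    proof
      assume "pattern_132 v a c"
      then obtain p q z m where "v = p @ a # q @ c # z" "m \<in> set q" "c < m" "a < c"
        by (auto simp: pattern_132_def)
      then have "w = (u @ M # p) @ a # q @ c # z" using w by simp
      then show False
        using Node.prems(3) \<open>m \<in> set q\<close> \<open>c < m\<close> \<open>a < c\<close> unfolding pattern_132_def by blast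
    qed
  qed (fact tuv)
  define u' where "u' = map (\<lambda>x. x - size r) u"
  have u: "u = map ((+) (size r)) u'"
    using su by (auto simp: u'_def intro!: map_idI[symmetric])
  have mono: "strict_mono_on A ((+) (size r))" for A by (simp add: strict_mono_onI)
  have du': "distinct u'" using du(1) u by (simp add: distinct_map)
  have u': "u' = max_word l"
  proof (rule Node.IH(1))
    have "set u' = (\<lambda>x. x - size r) ` {Suc (size r)..size l + size r}" by (simp add: u'_def su)
    also have "\<dots> = {1..size l}" by (force simp: image_iff intro: bexI[of _ "_ + size r"])
    finally show "u' \<in> permutations_of_set {1..size l}"
      using du' by (simp add: permutations_of_set_def)
    show "tau u' = l" using tau_map[OF mono du'] u tuv by simp
    show "\<not> pattern_132 u' a c" for a c
    proof
      assume "pattern_132 u' a c"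
      then obtain p q z m where p: "u' = p @ a # q @ c # z" "m \<in> set q" "c < m" "a < c"
        by (auto simp: pattern_132_def)
      let ?s = "map ((+) (size r))"
      have "w = ?s p @ (size r + a) # ?s q @ (size r + c) # (?s z @ M # v)" using w u p by simp
      moreover have "size r + m \<in> set (?s q)" "size r + c < size r + m" "size r + a < size r + c"
        using p by auto
      ultimately show False using Node.prems(3) unfolding pattern_132_def by blast
    qed
  qed
  show ?case using w(1) u u' v M by simp
qed

text \<open>Moving the larger of two letters to the left decreases this sum, so weak covers strictly decrease it.
  This gives both antisymmetry of the weak order and termination of climbing in a fiber.\<close>

definition position_weight :: "nat list \<Rightarrow> nat" where
  "position_weight w = (\<Sum>i < length w. i * w ! i)"

lemma weak_cover_position_weight:
  assumes "weak_cover w w'" "distinct w"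
  shows "distinct w'" "position_weight w' < position_weight w"
proof -
  from assms(1) obtain k i j where ij: "i < j" "j < length w" "w ! i = k" "w ! j = Suc k"
    and w': "w' = map (Transposition.transpose k (Suc k)) w"
    by (auto simp: weak_cover_def)
  show "distinct w'" using assms(2) w' by (simp add: distinct_map)
  have w'_nth: "w' ! i = Suc k" "w' ! j = k" using ij w' by auto
  have other: "w' ! x = w ! x" if "x < length w" "x \<noteq> i" "x \<noteq> j" for x
    proof -
    have "w ! x \<noteq> w ! i" "w ! x \<noteq> w ! j" using that ij(1,2) assms(2) by (simp_all only: nth_eq_iff_index_eq less_trans simp_thms)
    then show ?thesis using that ij w' by (simp add: transpose_def)
  qed
  have split: "(\<Sum>x < length w. x * v ! x)
      = i * v ! i + j * v ! j + (\<Sum>x \<in> {..<length w} - {i} - {j}. x * v ! x)" for v :: "nat list"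
  proof -
    have "(\<Sum>x < length w. x * v ! x) = i * v ! i + (\<Sum>x \<in> {..<length w} - {i}. x * v ! x)"
      using ij by (intro sum.remove) auto
    also have "(\<Sum>x \<in> {..<length w} - {i}. x * v ! x)
        = j * v ! j + (\<Sum>x \<in> {..<length w} - {i} - {j}. x * v ! x)"
      using ij by (intro sum.remove) auto
    finally show ?thesis by simp
  qed
  have "(\<Sum>x \<in> {..<length w} - {i} - {j}. x * w' ! x) = (\<Sum>x \<in> {..<length w} - {i} - {j}. x * w ! x)"
    using other by (intro sum.cong) auto
  moreover have "i * Suc k + j * k < i * k + j * Suc k" using ij by simp
  moreover have "length w' = length w" using w' by simp
  ultimately show "position_weight w' < position_weight w"
    unfolding position_weight_def using split[of w] split[of w'] w'_nth ij by simp
qed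

lemma weak_le_position_weight:
  assumes "weak_le v w" "distinct v"
  shows "distinct w \<and> (v = w \<or> position_weight w < position_weight v)"
  using assms unfolding weak_le_def
  by (induction rule: rtranclp_induct) (auto dest: weak_cover_position_weight)

text \<open>Climb in the fiber by swaps as long as the pattern 132 occurs.  The climb ends, and the only word of
  the fiber at which it can end is \<open>max_word t\<close>.\<close>

lemma weak_le_max_word:
  assumes "v \<in> fiber t"
  shows "weak_le v (max_word t)"
  using assms
proof (induction v rule: measure_induct_rule[where f = position_weight])
  case (less v)
  have v: "v \<in> permutations_of_set {1..size t}" "tau v = t" "distinct v" "set v = {1..size t}"
    using less.prems by (auto simp: fiber_def permutations_of_set_def)
  show ?case
  proof (cases "\<exists>a c. pattern_132 v a c")
    case False
    then have "v = max_word t" using avoids_132_eq_max_word v by blast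
    then show ?thesis by (simp add: weak_le_def)
  next
    case True
    then obtain k where "pattern_132 v k (Suc k)" using pattern_132_adjacent[OF v(1)] by blast
    then obtain p q z m where p: "v = p @ k # q @ Suc k # z" "m \<in> set q" "Suc k < m"
      by (auto simp: pattern_132_def)
    let ?v = "p @ Suc k # q @ k # z"
    have map: "?v = map (Transposition.transpose k (Suc k)) v"
      using v(3) unfolding p(1) by (auto simp: transpose_def intro!: map_idI[symmetric])
    have "weak_cover v ?v"
      unfolding weak_cover_def
    proof (intro exI conjI)
      show "length p < length p + Suc (length q)" by simp
      show "length p + Suc (length q) < length v" using p(1) by simp
      show "v ! length p = k" "v ! (length p + Suc (length q)) = Suc k"
        unfolding p(1) by (simp_all add: nth_append)
    qed (fact map)
    moreover have "?v \<in> fiber t"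
      using tau_swap[of p k q z m] v p by (auto simp: fiber_def permutations_of_set_def)
    ultimately show ?thesis
      using less.IH[of ?v] weak_cover_position_weight v(3)
      by (auto simp: weak_le_def intro: converse_rtranclp_into_rtranclp)
  qed
qed

lemma max_perm_eq: "max_perm t = max_word t"
  unfolding max_perm_def
proof (rule the_equality)
  have in_fiber: "max_word t \<in> fiber t"
    using max_word_permutation[of t] by (simp add: fiber_def tau_max_word)
  then show "max_word t \<in> fiber t \<and> (\<forall>v \<in> fiber t. weak_le v (max_word t))"
    by (simp add: weak_le_max_word)
  fix w assume w: "w \<in> fiber t \<and> (\<forall>v \<in> fiber t. weak_le v w)"
  have "distinct w" using w by (simp add: fiber_def permutations_of_set_def)
  then show "w = max_word t"
    using weak_le_position_weight[of w "max_word t"] weak_le_position_weight[of "max_word t" w]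
      w in_fiber weak_le_max_word[of w t] distinct_max_word[of t] by auto
qed

section \<open>The coaction on the monomial basis\<close>

lemma tensor_sum:
  "(\<Sum>x \<in> A. f x) \<^bold>\<otimes> (\<Sum>y \<in> B. g y) = (\<Sum>(x, y) \<in> A \<times> B. f x \<^bold>\<otimes> g y)"
proof (rule poly_mapping_eqI)
  fix k
  show "Poly_Mapping.lookup ((\<Sum>x \<in> A. f x) \<^bold>\<otimes> (\<Sum>y \<in> B. g y)) k =
      Poly_Mapping.lookup (\<Sum>(x, y) \<in> A \<times> B. f x \<^bold>\<otimes> g y) k"
    by (cases k) (simp add: lookup_tensor lookup_sum sum_product sum.cartesian_product split_beta)
qed

lemma F_bl_expand:
  assumes "b \<in> bileveled n"
  shows "F_bl b = (\<Sum>c \<in> {c. (b, c) \<in> bl_order n}. M_bl c)"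
proof (rule poly_mapping_eqI)
  fix x
  have "Poly_Mapping.lookup (F_bl b) x =
      (\<Sum>c \<in> {c. (b, c) \<in> bl_order n}. Poly_Mapping.lookup (M_bl c) x)"
  proof (rule mobius_inversion_converse[OF finite_bl_order partial_order_bl assms])
    fix b assume "b \<in> bileveled n"
    then have "size (fst b) = n" by (auto simp: bileveled_def Ytrees_def)
    then show "Poly_Mapping.lookup (M_bl b) x =
        (\<Sum>c \<in> {c. (b, c) \<in> bl_order n}.
          of_int (mobius (bl_order n) b c) * Poly_Mapping.lookup (F_bl c) x)"
      by (simp add: M_bl_def Let_def lookup_sum)
  qed
  then show "Poly_Mapping.lookup (F_bl b) x =
      Poly_Mapping.lookup (\<Sum>c \<in> {c. (b, c) \<in> bl_order n}. M_bl c) x"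
    by (simp add: lookup_sum)
qed

lemma F_tree_expand:
  assumes "t \<in> Ytrees n"
  shows "F_tree t = (\<Sum>s \<in> {s. (t, s) \<in> tamari_order n}. M_tree s)"
proof (rule poly_mapping_eqI)
  fix x
  have "Poly_Mapping.lookup (F_tree t) x =
      (\<Sum>s \<in> {s. (t, s) \<in> tamari_order n}. Poly_Mapping.lookup (M_tree s) x)"
  proof (rule mobius_inversion_converse[OF finite_tamari_order partial_order_tamari assms])
    fix t assume "t \<in> Ytrees n"
    then show "Poly_Mapping.lookup (M_tree t) x =
        (\<Sum>s \<in> {s. (t, s) \<in> tamari_order n}.
          of_int (mobius (tamari_order n) t s) * Poly_Mapping.lookup (F_tree s) x)"
      by (simp add: M_tree_def Let_def lookup_sum Ytrees_def)
  qed
  then show "Poly_Mapping.lookup (F_tree t) x =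
      Poly_Mapping.lookup (\<Sum>s \<in> {s. (t, s) \<in> tamari_order n}. M_tree s) x"
    by (simp add: lookup_sum)
qed

lemma rho_M_bl:
  assumes "b \<in> bileveled n"
  shows "rho (M_bl b) =
    (\<Sum>c \<in> {c. (b, c) \<in> bl_order n}. scale (of_int (mobius (bl_order n) b c)) (rho_F c))"
proof (rule poly_mapping_eqI)
  fix x
  let ?B = "{c. (b, c) \<in> bl_order n}"
  have sz: "size (fst b) = n" using assms by (auto simp: bileveled_def Ytrees_def)
  have fin: "finite ?B"
    by (rule finite_above[OF finite_bl_order])
  have M: "Poly_Mapping.lookup (M_bl b) c =
      (if c \<in> ?B then of_int (mobius (bl_order n) b c) else 0)" for c
  proof -
    have "Poly_Mapping.lookup (M_bl b) c =
        (\<Sum>d \<in> ?B. if d = c then of_int (mobius (bl_order n) b d) else 0)"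
      unfolding M_bl_def Let_def sz lookup_sum lookup_scale F_bl_def lookup_single when_def
      by (intro sum.cong) auto
    then show ?thesis using fin by simp
  qed
  then have "Poly_Mapping.keys (M_bl b) \<subseteq> ?B" by (auto simp: in_keys_iff split: if_splits)
  from lookup_rho[OF fin this] show "Poly_Mapping.lookup (rho (M_bl b)) x = Poly_Mapping.lookup
      (\<Sum>c \<in> ?B. scale (of_int (mobius (bl_order n) b c)) (rho_F c)) x"
    by (simp add: lookup_sum M)
qed

text \<open>The value claimed for \<open>\<rho>(M\<^sub>b)\<close>, with the condition \<open>b = \<beta>(max(t))\<close> expressed through the left spine.\<close>

definition coaction_M :: "bltree \<Rightarrow> (bltree \<times> pbt \<Rightarrow>\<^sub>0 rat)" where
  "coaction_M b = (\<Sum>(c, s) \<in> factorizations b. M_bl c \<^bold>\<otimes> M_tree s) +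
     (if snd b = left_spine (fst b) then one_msym \<^bold>\<otimes> M_tree (fst b) else 0)"

text \<open>The adjunction carried over to bi-leveled trees.  The order ideal of \<open>c\s\<close> is that of \<open>c\<close>, which lies
  in \<open>{1..p}\<close>, so only the part of \<open>T\<close> in \<open>{1..p}\<close> matters.\<close>

lemma graft_above_iff:
  assumes b: "(t, T) \<in> bileveled n" and c: "c \<in> bileveled p" "1 \<le> p" and s: "s \<in> Ytrees q"
  shows "((t, T), graft c s) \<in> bl_order n \<longleftrightarrow> p \<le> n \<and> q = n - p \<and>
    ((fst (split_tree t p), T \<inter> {1..p}), c) \<in> bl_order p \<and>
    (snd (split_tree t p), s) \<in> tamari_order q"
proof -
  obtain c' C where [simp]: "c = (c', C)" by force
  have sz: "size t = n" "size c' = p" "size s = q" "C \<subseteq> {1..p}"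
    using b c s by (auto simp: bileveled_def Ytrees_def)
  have g: "graft c s \<in> bileveled n \<longleftrightarrow> p + q = n"
    using bileveled_graft[OF c(1) s c(2)] sz
    by (auto simp: bileveled_def Ytrees_def graft_def size_graft_tree)
  show ?thesis
  proof (cases "p + q = n")
    case True
    then have p: "p \<le> n" by simp
    have "snd (split_tree t p) \<in> Ytrees q"
      using size_split_tree[of p t] sz True by (auto simp: Ytrees_def)
    then show ?thesis
      using True g bileveled_split[OF b p] b c s sz le_graft_iff[of t c' s]
      by (auto simp: bl_order_def tamari_order_def graft_def)
  next
    case False
    then show ?thesis using g by (auto simp: bl_order_def)
  qed
qed

text \<open>The factorization terms on the left match the splittings along leaves \<open>i \<ge> 1\<close> on the right, with \<open>i\<close> the
  degree of the first factor; the terms \<open>1 \<otimes> M\<^sub>s\<close> match the splitting along leaf \<open>0\<close>.\<close>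

lemma sum_coaction_M:
  assumes b: "(t, T) \<in> bileveled n"
  shows "(\<Sum>d \<in> {d. ((t, T), d) \<in> bl_order n}. coaction_M d) = rho_F (t, T)"
proof -
  let ?U = "{d. ((t, T), d) \<in> bl_order n}"
  let ?L = "\<lambda>i. {c. ((fst (split_tree t i), T \<inter> {1..i}), c) \<in> bl_order i}"
  let ?R = "\<lambda>i. {s. (snd (split_tree t i), s) \<in> tamari_order (n - i)}"
  let ?m = "\<lambda>(c, s). M_bl c \<^bold>\<otimes> M_tree s"
  have sz: "size t = n" using b by (auto simp: bileveled_def Ytrees_def)
  have finU: "finite ?U"
    by (rule finite_above[OF finite_bl_order])
  have finL: "finite (?L i)" for i
    by (rule finite_above[OF finite_bl_order])
  have finR: "finite (?R i)" for i
    by (rule finite_above[OF finite_tamari_order])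
  have summand: "F_bl (fst (split_tree t i), T \<inter> {1..i}) \<^bold>\<otimes> F_tree (snd (split_tree t i))
      = (\<Sum>x \<in> ?L i \<times> ?R i. ?m x)" if "i \<le> n" for i
  proof -
    have "snd (split_tree t i) \<in> Ytrees (n - i)"
      using size_split_tree[of i t] that sz by (simp add: Ytrees_def)
    then show ?thesis
      using F_bl_expand[OF bileveled_split[OF b that]] F_tree_expand by (simp add: tensor_sum)
  qed
  have "(\<Sum>d \<in> ?U. \<Sum>x \<in> factorizations d. ?m x) = (\<Sum>(d, x) \<in> Sigma ?U factorizations. ?m x)"
    by (rule sum.Sigma) (auto simp: finU finite_factorizations)
  also have "\<dots> = (\<Sum>(i, x) \<in> Sigma {1..n} (\<lambda>i. ?L i \<times> ?R i). ?m x)"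
  proof (rule sum.reindex_bij_witness[where
        i = "\<lambda>(i, (c, s)). (graft c s, (c, s))" and j = "\<lambda>(d, (c, s)). (size (fst c), (c, s))"])
    fix a assume "a \<in> Sigma ?U factorizations"
    then obtain d c s where a: "a = (d, (c, s))" "d \<in> ?U" "(c, s) \<in> factorizations d" by auto
    then obtain p q where pq: "1 \<le> p" "c \<in> bileveled p" "s \<in> Ytrees q" "d = graft c s"
      by (auto simp: factorizations_def)
    have p: "size (fst c) = p" using pq by (auto simp: bileveled_def Ytrees_def)
    show "(\<lambda>(i, (c, s)). (graft c s, (c, s))) ((\<lambda>(d, (c, s)). (size (fst c), (c, s))) a) = a"
      using a pq by simp
    show "(\<lambda>(d, (c, s)). (size (fst c), (c, s))) a \<in> Sigma {1..n} (\<lambda>i. ?L i \<times> ?R i)"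
      using a pq p graft_above_iff[OF b pq(2,1,3)] by auto
    show "(case (\<lambda>(d, (c, s)). (size (fst c), (c, s))) a of (i, x) \<Rightarrow> ?m x) = (case a of (d, x) \<Rightarrow> ?m x)"
      using a by simp
  next
    fix a assume "a \<in> Sigma {1..n} (\<lambda>i. ?L i \<times> ?R i)"
    then obtain i c s where a: "a = (i, (c, s))" "1 \<le> i" "i \<le> n" "c \<in> ?L i" "s \<in> ?R i" by auto
    then have cs: "c \<in> bileveled i" "s \<in> Ytrees (n - i)"
      by (auto simp: bl_order_def tamari_order_def)
    have p: "size (fst c) = i" using cs by (auto simp: bileveled_def Ytrees_def)
    show "(\<lambda>(d, (c, s)). (size (fst c), (c, s))) ((\<lambda>(i, (c, s)). (graft c s, (c, s))) a) = a"
      using a p by simp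
    show "(\<lambda>(i, (c, s)). (graft c s, (c, s))) a \<in> Sigma ?U factorizations"
      using a cs graft_above_iff[OF b cs(1) a(2) cs(2)] by (auto simp: factorizations_def)
  qed
  also have "\<dots> = (\<Sum>i \<in> {1..n}. \<Sum>x \<in> ?L i \<times> ?R i. ?m x)"
    by (rule sum.Sigma[symmetric]) (intro ballI finite_cartesian_product finL finR finite_atLeastAtMost)+
  finally have pos: "(\<Sum>d \<in> ?U. \<Sum>x \<in> factorizations d. ?m x) =
      (\<Sum>i \<in> {1..n}. \<Sum>x \<in> ?L i \<times> ?R i. ?m x)" .
  have M0: "F_tree t = (\<Sum>s \<in> {s. (t, s) \<in> tamari_order n}. M_tree s)"
    by (rule F_tree_expand) (simp add: Ytrees_def sz)
  \<comment> \<open>Every \<open>s \<ge> t\<close> carries exactly one such \<open>d\<close> above \<open>(t; T)\<close>, since its left spine lies in \<open>T\<close>.\<close>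
  have "(\<Sum>d \<in> ?U. if snd d = left_spine (fst d) then one_msym \<^bold>\<otimes> M_tree (fst d) else 0)
      = (\<Sum>d \<in> {d \<in> ?U. snd d = left_spine (fst d)}. one_msym \<^bold>\<otimes> M_tree (fst d))"
    by (rule sum.inter_filter[symmetric, OF finU])
  also have "\<dots> = (\<Sum>s \<in> {s. (t, s) \<in> tamari_order n}. one_msym \<^bold>\<otimes> M_tree s)"
  proof (rule sum.reindex_bij_witness[where i = "\<lambda>s. (s, left_spine s)" and j = fst])
    fix s assume "s \<in> {s. (t, s) \<in> tamari_order n}"
    then have s: "tamari_le t s" "size s = n" by (auto simp: tamari_order_def Ytrees_def)
    then have "left_spine s \<subseteq> T" using left_spine_antimono left_spine_subset[OF b] by blast
    then show "(s, left_spine s) \<in> {d \<in> ?U. snd d = left_spine (fst d)}"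
      using s b bileveled_left_spine[of s] by (simp add: bl_order_def)
  qed (auto simp: bl_order_def tamari_order_def bileveled_def)
  also have "\<dots> = one_msym \<^bold>\<otimes> F_tree t"
    using tensor_sum[of "\<lambda>_. one_msym" "{()}" M_tree "{s. (t, s) \<in> tamari_order n}"] M0
    by (simp add: sum.cartesian_product[symmetric])
  finally have zero: "(\<Sum>d \<in> ?U. if snd d = left_spine (fst d) then one_msym \<^bold>\<otimes> M_tree (fst d) else 0)
      = one_msym \<^bold>\<otimes> F_tree t" .
  have "rho_F (t, T) = (\<Sum>i \<in> {0..n}.
      F_bl (fst (split_tree t i), T \<inter> {1..i}) \<^bold>\<otimes> F_tree (snd (split_tree t i)))"
    by (simp add: rho_F_def split_bl_def phi_def sz)
  also have "\<dots> = one_msym \<^bold>\<otimes> F_tree t + (\<Sum>i \<in> {1..n}.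
      F_bl (fst (split_tree t i), T \<inter> {1..i}) \<^bold>\<otimes> F_tree (snd (split_tree t i)))"
    by (simp add: sum.atLeast_Suc_atMost[of 0] split_tree_0 one_msym_def)
  also have "(\<Sum>i \<in> {1..n}.
      F_bl (fst (split_tree t i), T \<inter> {1..i}) \<^bold>\<otimes> F_tree (snd (split_tree t i)))
      = (\<Sum>d \<in> ?U. \<Sum>x \<in> factorizations d. ?m x)"
    unfolding pos using summand by (intro sum.cong) auto
  finally show ?thesis
    by (simp add: coaction_M_def sum.distrib zero)
qed

theorem theorem3p6:
  fixes t :: pbt and T :: "nat set"
  assumes "(t, T) \<in> bileveled_trees"
  shows "rho (M_bl (t, T)) =
    (if (t, T) \<noteq> beta (max_perm t)
     then (\<Sum>(c, s) \<in> factorizations (t, T). M_bl c \<^bold>\<otimes> M_tree s)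
     else (\<Sum>(c, s) \<in> factorizations (t, T). M_bl c \<^bold>\<otimes> M_tree s) + one_msym \<^bold>\<otimes> M_tree t)"
proof -
  obtain n where b: "(t, T) \<in> bileveled n" using assms by (auto simp: bileveled_trees_def)
  have "rho (M_bl (t, T)) = coaction_M (t, T)"
  proof (rule poly_mapping_eqI)
    fix x
    let ?r = "bl_order n"
    have "Poly_Mapping.lookup (rho (M_bl (t, T))) x =
        (\<Sum>c \<in> {c. ((t, T), c) \<in> ?r}.
          of_int (mobius ?r (t, T) c) * Poly_Mapping.lookup (rho_F c) x)"
      by (simp add: rho_M_bl[OF b] lookup_sum)
    also have "\<dots> = (\<Sum>c \<in> {c. ((t, T), c) \<in> ?r}. of_int (mobius ?r (t, T) c) *
          (\<Sum>d \<in> {d. (c, d) \<in> ?r}. Poly_Mapping.lookup (coaction_M d) x))"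
    proof (intro sum.cong refl)
      fix c assume "c \<in> {c. ((t, T), c) \<in> ?r}"
      then have c: "(fst c, snd c) \<in> bileveled n" by (auto simp: bl_order_def)
      from sum_coaction_M[OF this]
      show "of_int (mobius ?r (t, T) c) * Poly_Mapping.lookup (rho_F c) x =
          of_int (mobius ?r (t, T) c) *
          (\<Sum>d \<in> {d. (c, d) \<in> ?r}. Poly_Mapping.lookup (coaction_M d) x)"
        by (simp flip: lookup_sum)
    qed
    also have "\<dots> = Poly_Mapping.lookup (coaction_M (t, T)) x"
      by (rule mobius_inversion[OF finite_bl_order partial_order_bl b])
    finally show "Poly_Mapping.lookup (rho (M_bl (t, T))) x =
        Poly_Mapping.lookup (coaction_M (t, T)) x" .
  qed
  moreover have "(t, T) = beta (max_perm t) \<longleftrightarrow> T = left_spine t"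
    by (simp add: max_perm_eq beta_max_word)
  ultimately show ?thesis by (simp add: coaction_M_def)
qed

end
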